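(* Let $A$ be an invertible real $n\times n$ matrix, let $0\le\alpha<n$, $1\le p<n/\alpha$ (with $n/\alpha=\infty$ if $\alpha=0$) and $\frac1q=\frac1p-\frac{\alpha}{n}$, and let $w$ be a weight on $\mathbb{R}^n$. The maximal operator $M_{\alpha,A^{-1}}$ is bounded from $L^p(w^p)$ into $L^{q,\infty}(w^q)$ if and only if $w\in\mathcal{A}_{A,p,q}$.
   Context: A weight is a nonnegative function $w\in L^1_{loc}(\mathbb{R}^n)$; $w_A(x):=w(Ax)$. $L^p(w^p)$ denotes the space $L^p(\mathbb{R}^n,w^p\,dx)$ and $L^{q,\infty}(w^q)$ the weak $L^q$ space with respect to $w^q\,dx$. $Q$ denotes cubes in $\mathbb{R}^n$ with sides parallel to the axes. The maximal operator is $$M_{\alpha,A^{-1}}f(x)=M_\alpha f(A^{-1}x)=\sup_{Q\ni A^{-1}x}\frac{1}{|Q|^{1-\alpha/n}}\int_Q|f(y)|\,dy .$$ The class $\mathcal{A}_{A,p,q}$ ($1\le p\le q<\infty$) consists of weights $w$ with $[w]_{\mathcal{A}_{A,p,q}}<\infty$, where for $p>1$ $$[w]_{\mathcal{A}_{A,p,q}}=\sup_Q\Big(\frac1{|Q|}\int_Q w_A^q(x)\,dx\Big)^{1/q}\Big(\frac1{|Q|}\int_Q w^{-p'}(x)\,dx\Big)^{1/p'},$$ with $\frac1p+\frac1{p'}=1$, and for $p=1$ $$[w]_{\mathcal{A}_{A,1,q}}=\sup_Q\Big(\frac1{|Q|}\int_Q w_A^q(x)\,dx\Big)^{1/q}\|w^{-1}\|_{\infty,Q},$$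 where $\|w^{-1}\|_{\infty,Q}$ is the essential supremum of $w^{-1}$ on $Q$. *)

theory Defs
  imports "HOL-Analysis.Analysis" "HOL-Probability.Essential_Supremum"
begin

definition weight :: "(real^'n \<Rightarrow> real) \<Rightarrow> bool" where
  "weight w \<longleftrightarrow> (\<forall>x. 0 \<le> w x) \<and> (\<forall>K. compact K \<longrightarrow> w absolutely_integrable_on K)"

definition cubes :: "(real^'n) set set" where
  "cubes = {cbox a (\<chi> i. a $ i + l) | a l. 0 < l}"

text \<open>Real powers of an extended nonnegative number. Only exponents \<open>s > 0\<close> are used below,
  so that \<open>0\<close> and \<open>\<infinity>\<close> are mapped to themselves.\<close>

definition epowr :: "ennreal \<Rightarrow> real \<Rightarrow> ennreal" where
  "epowr x s = (if x = \<infinity> then \<infinity> else ennreal (enn2real x powr s))"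

definition conjugate_exponent :: "real \<Rightarrow> real" where
  "conjugate_exponent p = p / (p - 1)"

lemma conjugate_exponent:
  assumes "1 < p"
  shows "1 / p + 1 / conjugate_exponent p = 1"
  using assms by (simp add: conjugate_exponent_def field_simps)

text \<open>The measure \<open>v dx\<close>.\<close>

definition weighted_measure :: "(real^'n \<Rightarrow> real) \<Rightarrow> (real^'n) measure" where
  "weighted_measure v = density lebesgue (\<lambda>x. ennreal (v x))"

definition Lp_norm :: "'a measure \<Rightarrow> real \<Rightarrow> ('a \<Rightarrow> real) \<Rightarrow> ennreal" where
  "Lp_norm M p f = epowr (\<integral>\<^sup>+x. ennreal (\<bar>f x\<bar> powr p) \<partial>M) (1 / p)"

definition Lp_space :: "'a measure \<Rightarrow> real \<Rightarrow> ('a \<Rightarrow> real) set" where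
  "Lp_space M p = {f \<in> borel_measurable M. Lp_norm M p f < \<infinity>}"

text \<open>Weak spaces are stated for functions with values in \<open>[0,\<infinity>]\<close>, since a maximal function may
  be infinite at some points.\<close>

definition weak_Lp_norm :: "'a measure \<Rightarrow> real \<Rightarrow> ('a \<Rightarrow> ennreal) \<Rightarrow> ennreal" where
  "weak_Lp_norm M q g =
     (SUP t\<in>{0<..}. ennreal t * epowr (emeasure M {x \<in> space M. ennreal t < g x}) (1 / q))"

definition weak_Lp_space :: "'a measure \<Rightarrow> real \<Rightarrow> ('a \<Rightarrow> ennreal) set" where
  "weak_Lp_space M q = {g \<in> borel_measurable M. weak_Lp_norm M q g < \<infinity>}"

definition bounded_Lp_weak_Lq ::
  "'a measure \<Rightarrow> real \<Rightarrow> 'b measure \<Rightarrow> real \<Rightarrow> (('a \<Rightarrow> real) \<Rightarrow> 'b \<Rightarrow> ennreal) \<Rightarrow> bool" where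
  "bounded_Lp_weak_Lq M p N q T \<longleftrightarrow>
     (\<exists>C::real. \<forall>f \<in> Lp_space M p.
        T f \<in> weak_Lp_space N q \<and> weak_Lp_norm N q (T f) \<le> ennreal C * Lp_norm M p f)"

definition fractional_maximal :: "real \<Rightarrow> (real^'n \<Rightarrow> real) \<Rightarrow> real^'n \<Rightarrow> ennreal" where
  "fractional_maximal \<alpha> f x =
     (SUP Q\<in>{Q \<in> cubes. x \<in> Q}.
        (\<integral>\<^sup>+y\<in>Q. ennreal \<bar>f y\<bar> \<partial>lebesgue)
          / ennreal (measure lebesgue Q powr (1 - \<alpha> / real CARD('n))))"

definition maximal_inv_matrix ::
  "real \<Rightarrow> real^'n^'n \<Rightarrow> (real^'n \<Rightarrow> real) \<Rightarrow> real^'n \<Rightarrow> ennreal" where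
  "maximal_inv_matrix \<alpha> A f x = fractional_maximal \<alpha> f (matrix_inv A *v x)"

definition average :: "(real^'n) set \<Rightarrow> (real^'n \<Rightarrow> ennreal) \<Rightarrow> ennreal" where
  "average Q g = (\<integral>\<^sup>+x\<in>Q. g x \<partial>lebesgue) / emeasure lebesgue Q"

text \<open>\<open>w\<^sup>-\<^sup>1\<close> is formed in \<open>ennreal\<close>, so it is \<open>\<infinity>\<close> where \<open>w = 0\<close> (in \<open>real\<close> it would be \<open>0\<close>).
  Products \<open>0 \<cdot> \<infinity>\<close> are \<open>0\<close>, as is usual for such constants.\<close>

definition A_const :: "real^'n^'n \<Rightarrow> real \<Rightarrow> real \<Rightarrow> (real^'n \<Rightarrow> real) \<Rightarrow> ennreal" where
  "A_const A p q w =
     (SUP Q\<in>cubes.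
        epowr (average Q (\<lambda>x. ennreal (w (A *v x) powr q))) (1 / q) *
        (if p = 1 then esssup (lebesgue_on Q) (\<lambda>x. inverse (ennreal (w x)))
         else let p' = conjugate_exponent p
              in epowr (average Q (\<lambda>x. epowr (inverse (ennreal (w x))) p')) (1 / p')))"

definition A_class :: "real^'n^'n \<Rightarrow> real \<Rightarrow> real \<Rightarrow> (real^'n \<Rightarrow> real) set" where
  "A_class A p q = {w. weight w \<and> A_const A p q w < \<infinity>}"

end

theory Submission
  imports Defs
begin

text \<open>
  Write $N(Q)$ for the second factor in the definition of the class. By duality it is the best
  constant in
  $\int_Q |f| \le N(Q) |Q|^{1-1/p} (\int_Q |f|^p w^p)^{1/p}$.
  Testing the weak-type inequality on $f 1_Q$, whose maximal function is at least
  $|Q|^{\alpha/n-1} \int_Q |f|$ on $Q$, therefore gives necessity. For sufficiency, a superlevel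
  set of the maximal function is exhausted by finite unions of cubes with large averages; Vitali's
  lemma selects disjoint cubes $Q_j$ whose triples cover them. Applying the condition on $3Q_j$ and
  the inequality above to $f 1_{Q_j}$ bounds the mass of $3Q_j$ by the integral of $|f|^p w^p$ over $Q_j$ to the
  power $q/p \ge 1$, so no doubling property is needed, and these bounds add up. The matrix only enters
  through the change of variables $x \mapsto Ax$, which multiplies Lebesgue measure by a constant.
\<close>

text \<open>The relation between the exponents reads $1/q + 1/p' = 1 - \<alpha>/n$. Hence the
  volumes coming from the two averages in the condition combine to the power of $|Q|$ that
  normalises the maximal operator, and they cancel in both directions. The assumption $0 \<le>
  \<alpha>$ gives $p \<le> q$, which is what makes $q/p$-th powers superadditive. Passing to triples
  costs $3^{n(1-\<alpha>/n)}$; the matrix contributes $m^{1/q}$, where $m = |det A|$, to the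
  operator bound and its inverse to the bound for the weight constant.

  Two obstacles shape the details. The weight may vanish on a set of positive measure, and $N(Q)$ or
  the maximal function may be infinite; so the estimates live in $[0,\<infinity>]$ with $0 \<cdot>
  \<infinity> = 0$, and each cancellation is preceded by a proof that the cancelled quantity is
  finite and nonzero. Moreover the supremum runs over uncountably many closed cubes. Enlarging a
  cube slightly keeps a strict inequality for its average, so superlevel sets are unions of open
  boxes; this gives measurability, and Lindelof's theorem then gives countable subcovers.\<close>

section \<open>Lebesgue measure under linear bijections\<close>

lemma nn_integral_lborel_shift:
  fixes g :: "'a::euclidean_space \<Rightarrow> ennreal"
  assumes [measurable]: "g \<in> borel_measurable borel"
  shows "(\<integral>\<^sup>+x. g (c + x) \<partial>lborel) = (\<integral>\<^sup>+x. g x \<partial>lborel)"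
proof -
  have "(\<integral>\<^sup>+x. g x \<partial>lborel) = (\<integral>\<^sup>+x. g x \<partial>distr lborel borel ((+) c))"
    by (simp add: lborel_distr_plus)
  also have "\<dots> = (\<integral>\<^sup>+x. g (c + x) \<partial>lborel)"
    by (subst nn_integral_distr) auto
  finally show ?thesis by simp
qed

lemma nn_integral_lborel_reflect:
  fixes g :: "'a::euclidean_space \<Rightarrow> ennreal"
  assumes [measurable]: "g \<in> borel_measurable borel"
  shows "(\<integral>\<^sup>+x. g (c - x) \<partial>lborel) = (\<integral>\<^sup>+x. g x \<partial>lborel)"
proof -
  have "(\<integral>\<^sup>+x. g x \<partial>lborel)
      = (\<integral>\<^sup>+x. g x \<partial>density (distr lborel borel (\<lambda>x. c + (-1) *\<^sub>R x)) (\<lambda>_. ennreal (\<bar>-1\<bar>^DIM('a))))"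
    by (subst lborel_affine[of "-1" c, symmetric]) simp_all
  also have "\<dots> = (\<integral>\<^sup>+x. g (c - x) \<partial>lborel)"
    by (simp add: nn_integral_density nn_integral_distr)
  finally show ?thesis by simp
qed

text \<open>Uniqueness of Haar measure by Fubini, applied to the translation-invariant image of
  Lebesgue measure. The library only has \<open>measure_linear_image\<close> for well-ordered index types.\<close>

lemma nn_integral_lborel_linear_exchange:
  fixes T S :: "'a::euclidean_space \<Rightarrow> 'a" and g h :: "'a \<Rightarrow> ennreal"
  assumes "linear T" "linear S" and TS: "\<And>x. T (S x) = x"
    and [measurable]: "g \<in> borel_measurable borel" "h \<in> borel_measurable borel"
  shows "(\<integral>\<^sup>+x. g (T x) \<partial>lborel) * (\<integral>\<^sup>+x. h x \<partial>lborel)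
       = (\<integral>\<^sup>+x. h (T x) \<partial>lborel) * (\<integral>\<^sup>+x. g x \<partial>lborel)"
proof -
  have [measurable]: "T \<in> borel_measurable borel" "S \<in> borel_measurable borel"
    using assms(1,2) by (auto intro!: borel_measurable_continuous_onI linear_continuous_on
        simp: linear_conv_bounded_linear)
  have "(\<integral>\<^sup>+x. g (T x) \<partial>lborel) * (\<integral>\<^sup>+x. h x \<partial>lborel)
      = (\<integral>\<^sup>+x. g (T x) * (\<integral>\<^sup>+y. h (T x + y) \<partial>lborel) \<partial>lborel)"
    by (simp add: nn_integral_lborel_shift nn_integral_multc)
  also have "\<dots> = (\<integral>\<^sup>+x. \<integral>\<^sup>+y. g (T x) * h (T x + y) \<partial>lborel \<partial>lborel)"
    by (simp add: nn_integral_cmult)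
  also have "\<dots> = (\<integral>\<^sup>+y. \<integral>\<^sup>+x. g (T x) * h (T x + y) \<partial>lborel \<partial>lborel)"
    by (rule lborel_pair.Fubini') measurable
  \<comment> \<open>Translating \<open>x\<close> by \<open>S (- y)\<close> changes
    \<open>T x\<close> by \<open>- y\<close>. This is the translation invariance of the image
    measure; it moves \<open>y\<close> from \<open>h\<close> to \<open>g\<close>, where a reflection
    disposes of the integral over \<open>y\<close>.\<close>
  also have "\<dots> = (\<integral>\<^sup>+y. \<integral>\<^sup>+x. g (T x - y) * h (T x) \<partial>lborel \<partial>lborel)"
  proof (rule nn_integral_cong)
    fix y
    have "(\<integral>\<^sup>+x. g (T x) * h (T x + y) \<partial>lborel)
        = (\<integral>\<^sup>+x. g (T (S (- y) + x)) * h (T (S (- y) + x) + y) \<partial>lborel)"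
      by (rule nn_integral_lborel_shift[symmetric]) measurable
    also have "\<dots> = (\<integral>\<^sup>+x. g (T x - y) * h (T x) \<partial>lborel)"
      by (simp add: linear_add[OF assms(1)] TS algebra_simps)
    finally show "(\<integral>\<^sup>+x. g (T x) * h (T x + y) \<partial>lborel) = (\<integral>\<^sup>+x. g (T x - y) * h (T x) \<partial>lborel)" .
  qed
  also have "\<dots> = (\<integral>\<^sup>+x. \<integral>\<^sup>+y. g (T x - y) * h (T x) \<partial>lborel \<partial>lborel)"
    by (rule lborel_pair.Fubini') measurable
  also have "\<dots> = (\<integral>\<^sup>+x. h (T x) * (\<integral>\<^sup>+y. g (T x - y) \<partial>lborel) \<partial>lborel)"
    by (simp add: mult.commute[of "g _"] nn_integral_cmult)
  also have "\<dots> = (\<integral>\<^sup>+x. h (T x) \<partial>lborel) * (\<integral>\<^sup>+x. g x \<partial>lborel)"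
    by (simp add: nn_integral_lborel_reflect nn_integral_multc)
  finally show ?thesis .
qed

text \<open>With \<open>h\<close> the indicator of the unit box, the exchange identity says that
  taking preimages under \<open>T\<close> multiplies Borel measure by \<open>c\<close>, the measure
  of the preimage of that box. This preimage is bounded, open and nonempty, so \<open>c\<close> is
  finite and nonzero. The factor \<open>m = 1 / c\<close> equals $|det T|$.\<close>

lemma lborel_linear_scaling:
  fixes T S :: "'a::euclidean_space \<Rightarrow> 'a"
  assumes T: "linear T" and S: "linear S" and TS: "\<And>x. T (S x) = x" and ST: "\<And>x. S (T x) = x"
  obtains m :: real where "0 < m" "lborel = density (distr lborel borel T) (\<lambda>_. ennreal m)"
proof -
  have [measurable]: "T \<in> borel_measurable borel"
    using T by (auto intro!: borel_measurable_continuous_onI linear_continuous_on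
        simp: linear_conv_bounded_linear)
  have contT: "continuous_on UNIV T"
    using T by (simp add: linear_continuous_on linear_conv_bounded_linear)
  define B :: "'a set" where "B = box 0 One"
  have [measurable]: "B \<in> sets borel" by (simp add: B_def)
  have B1: "emeasure lborel B = 1"
    by (simp add: B_def emeasure_lborel_box_eq)
  have vB: "T -` B = S ` B" using TS ST by (auto simp: image_iff) metis
  define c where "c = emeasure lborel (T -` B)"
  have "bounded (S ` B)"
    by (intro bounded_linear_image) (auto simp: B_def S linear_conv_bounded_linear[symmetric])
  then have cfin: "c < \<infinity>" using emeasure_bounded_finite[of "S ` B"] unfolding c_def vB by simp
  have "open (T -` B)" using contT continuous_on_open_vimage[OF open_UNIV, of T] by (auto simp: B_def open_box)
  moreover have "B \<noteq> {}" using B1 by force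
  then have "T -` B \<noteq> {}" by (simp add: vB)
  ultimately have "c \<noteq> 0"
    using open_not_negligible[of "T -` B"] unfolding c_def negligible_iff_null_sets
    by (auto simp: null_sets_def borel_open)
  obtain r where r: "c = ennreal r" "0 < r"
    using cfin \<open>c \<noteq> 0\<close> by (cases c) (auto simp: less_le)
  have *: "emeasure lborel (T -` E) = c * emeasure lborel E" if [measurable]: "E \<in> sets borel" for E
  proof -
    have "(\<integral>\<^sup>+x. indicator E (T x) \<partial>lborel) * (\<integral>\<^sup>+x. indicator B x \<partial>lborel)
       = (\<integral>\<^sup>+x. indicator B (T x) \<partial>lborel) * (\<integral>\<^sup>+x. indicator E x \<partial>lborel)"
      by (rule nn_integral_lborel_linear_exchange[OF T S TS]) auto
    moreover have "(\<integral>\<^sup>+x. indicator F (T x) \<partial>lborel) = emeasure lborel (T -` F)"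
      if [measurable]: "F \<in> sets borel" for F
    proof -
      have "(\<integral>\<^sup>+x. indicator F (T x) \<partial>lborel) = (\<integral>\<^sup>+x. indicator (T -` F) x \<partial>lborel)"
        by (intro nn_integral_cong) (auto simp: indicator_def)
      moreover have "T -` F \<in> sets borel"
        using measurable_sets[OF \<open>T \<in> borel_measurable borel\<close> that] by simp
      ultimately show ?thesis by simp
    qed
    ultimately show ?thesis by (simp add: B1 c_def)
  qed
  show ?thesis
  proof
    show "0 < 1 / r" using r by simp
    show "lborel = density (distr lborel borel T) (\<lambda>_. ennreal (1 / r))"
    proof (rule measure_eqI)
      fix E :: "'a set" assume "E \<in> sets lborel"
      then have E [measurable]: "E \<in> sets borel" by simp
      have "emeasure (density (distr lborel borel T) (\<lambda>_. ennreal (1 / r))) E = ennreal (1 / r) * (c * emeasure lborel E)"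
        by (simp add: emeasure_density nn_integral_cmult emeasure_distr *)
      also have "\<dots> = ennreal (1 / r * r) * emeasure lborel E"
        using r by (subst ennreal_mult) (auto simp: mult.assoc)
      finally show "emeasure lborel E = emeasure (density (distr lborel borel T) (\<lambda>_. ennreal (1 / r))) E"
        using r by simp
    qed simp
  qed
qed

text \<open>Since \<open>m\<close> is positive, Lebesgue measure and its image under
  \<open>T\<close> have the same null sets, so the Borel scaling passes to completions. The
  completed form is required because weights and test functions are only Lebesgue
  measurable.\<close>

lemma lebesgue_linear_scaling:
  fixes T S :: "'a::euclidean_space \<Rightarrow> 'a"
  assumes T: "linear T" and S: "linear S" and TS: "\<And>x. T (S x) = x" and ST: "\<And>x. S (T x) = x"
  obtains m :: real where "0 < m" "T \<in> lebesgue \<rightarrow>\<^sub>M lebesgue"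
    "\<And>f. f \<in> borel_measurable lebesgue \<Longrightarrow> (\<integral>\<^sup>+x. f x \<partial>lebesgue) = ennreal m * (\<integral>\<^sup>+x. f (T x) \<partial>lebesgue)"
proof -
  obtain m :: real where m: "0 < m" and eqm: "lborel = density (distr lborel borel T) (\<lambda>_. ennreal m)"
    using lborel_linear_scaling[OF assms] by blast
  have T_borel[measurable]: "T \<in> borel \<rightarrow>\<^sub>M borel"
    using T by (auto intro!: borel_measurable_continuous_onI linear_continuous_on
        simp: linear_conv_bounded_linear)
  { fix A :: "'a set" assume A: "A \<in> sets borel"
    then have "emeasure lborel A = 0 \<longleftrightarrow> emeasure (density (distr lborel borel T) (\<lambda>_. ennreal m)) A = 0"
      by (subst eqm[symmetric]) auto
    also have "\<dots> \<longleftrightarrow> emeasure (distr lebesgue lborel T) A = 0"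
      using A m by (simp add: distr_completion emeasure_density nn_integral_cmult cong: distr_cong)
    finally have "emeasure lborel A = 0 \<longleftrightarrow> emeasure (distr lebesgue lborel T) A = 0" . }
  then have eq: "null_sets lborel = null_sets (distr lebesgue lborel T)"
    by (auto simp: null_sets_def)
  have meas: "T \<in> lebesgue \<rightarrow>\<^sub>M lebesgue"
    by (simp add: completion.measurable_completion2 eq measurable_completion)
  have "lebesgue = completion (density (distr lborel borel T) (\<lambda>_. ennreal m))"
    using eqm by simp
  also have "\<dots> = density (completion (distr lebesgue lborel T)) (\<lambda>_. ennreal m)"
    using m by (auto intro!: always_eventually completion_density_eq simp: distr_completion cong: distr_cong)
  also have "\<dots> = density (distr lebesgue lebesgue T) (\<lambda>_. ennreal m)"
    by (subst completion.completion_distr_eq) (auto simp: eq measurable_completion)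
  finally have leb: "lebesgue = density (distr lebesgue lebesgue T) (\<lambda>_. ennreal m)" .
  have "(\<integral>\<^sup>+x. f x \<partial>lebesgue) = ennreal m * (\<integral>\<^sup>+x. f (T x) \<partial>lebesgue)"
    if [measurable]: "f \<in> borel_measurable lebesgue" for f
  proof -
    note [measurable] = meas
    have "(\<integral>\<^sup>+x. f x \<partial>lebesgue) = (\<integral>\<^sup>+x. f x \<partial>density (distr lebesgue lebesgue T) (\<lambda>_. ennreal m))"
      using leb by simp
    also have "\<dots> = (\<integral>\<^sup>+x. ennreal m * f x \<partial>distr lebesgue lebesgue T)"
      by (subst nn_integral_density) auto
    also have "\<dots> = ennreal m * (\<integral>\<^sup>+x. f (T x) \<partial>lebesgue)"
      by (subst nn_integral_distr) (auto simp: nn_integral_cmult)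
    finally show ?thesis .
  qed
  with m meas show ?thesis by (rule that)
qed

section \<open>Extended powers and the Hoelder inequality\<close>

lemma epowr_ennreal: "0 \<le> x \<Longrightarrow> epowr (ennreal x) s = ennreal (x powr s)"
  by (simp add: epowr_def)

lemma epowr_top [simp]: "epowr top s = top"
  by (simp add: epowr_def)

lemma epowr_0 [simp]: "epowr 0 s = 0"
  by (simp add: epowr_def)

lemma epowr_1 [simp]: "epowr x 1 = x"
  by (cases x) (auto simp: epowr_ennreal)

lemma epowr_eq_0_iff [simp]: "epowr x s = 0 \<longleftrightarrow> x = 0"
  by (cases x) (auto simp: epowr_ennreal)

lemma epowr_eq_top_iff [simp]: "epowr x s = top \<longleftrightarrow> x = top"
  by (cases x) (auto simp: epowr_ennreal)

lemma epowr_mono: "x \<le> y \<Longrightarrow> 0 \<le> s \<Longrightarrow> epowr x s \<le> epowr y s"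
  by (cases x; cases y) (auto simp: epowr_ennreal powr_mono2 top_unique)

lemma epowr_mult: "epowr (x * y) s = epowr x s * epowr y s"
  by (cases x; cases y)
     (auto simp: epowr_ennreal ennreal_mult[symmetric] powr_mult ennreal_mult_top ennreal_top_mult)

lemma epowr_epowr: "epowr (epowr x s) t = epowr x (s * t)"
  by (cases x) (auto simp: epowr_ennreal powr_powr)

lemma epowr_le_iff:
  assumes "0 < s"
  shows "epowr x s \<le> epowr y s \<longleftrightarrow> x \<le> y"
  using epowr_mono[of "epowr x s" "epowr y s" "1 / s"] epowr_mono[of x y s] assms
  by (auto simp: epowr_epowr)

lemma borel_measurable_epowr [measurable]: "(\<lambda>x. epowr x s) \<in> borel_measurable borel"
  unfolding epowr_def by measurable

text \<open>Each $u$ among $x, y$ is at most $x + y$, so $u^s \<le> u (x+y)^{s-1}$; the two bounds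
  are added.\<close>

lemma powr_superadditive:
  fixes x y s :: real
  assumes "0 \<le> x" "0 \<le> y" "1 \<le> s"
  shows "x powr s + y powr s \<le> (x + y) powr s"
proof -
  have *: "u powr s \<le> u * (x + y) powr (s - 1)" if "0 \<le> u" "u \<le> x + y" for u
  proof (cases "u = 0")
    case False
    then have "u powr s = u * u powr (s - 1)"
      using that by (simp add: powr_diff)
    also have "\<dots> \<le> u * (x + y) powr (s - 1)"
      using that assms by (intro mult_left_mono powr_mono2) auto
    finally show ?thesis .
  qed simp
  have "x powr s + y powr s \<le> (x + y) * (x + y) powr (s - 1)"
    using *[of x] *[of y] assms by (simp add: distrib_right)
  also have "\<dots> = (x + y) powr s"
    using assms by (cases "x + y = 0") (auto simp: powr_diff)
  finally show ?thesis .
qed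

lemma epowr_superadditive:
  assumes "1 \<le> s"
  shows "epowr x s + epowr y s \<le> epowr (x + y) s"
proof (cases x; cases y)
  fix a b assume "x = ennreal a" "0 \<le> a" "y = ennreal b" "0 \<le> b"
  then show ?thesis
    using powr_superadditive[of a b s] assms
    by (simp add: epowr_ennreal ennreal_plus[symmetric] del: ennreal_plus)
qed auto

text \<open>Used with \<open>s = q / p\<close>, to gather the bounds over disjoint cubes into a
  power of one total integral.\<close>

lemma sum_epowr_le_epowr_sum:
  assumes "1 \<le> s"
  shows "(\<Sum>i\<in>I. epowr (x i) s) \<le> epowr (\<Sum>i\<in>I. x i) s"
proof (induction I rule: infinite_finite_induct)
  case (insert i I)
  have "epowr (x i) s + (\<Sum>i\<in>I. epowr (x i) s) \<le> epowr (x i) s + epowr (\<Sum>i\<in>I. x i) s"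
    using insert by (intro add_left_mono)
  also have "\<dots> \<le> epowr (x i + (\<Sum>i\<in>I. x i)) s"
    using assms by (rule epowr_superadditive)
  finally show ?case using insert by simp
qed auto

text \<open>Any \<open>x\<close> is the supremum of the positive values strictly below it, and
  multiplication commutes with suprema. This fits the weak norm, which sees only strict superlevel
  sets at real levels, while the lower bound \<open>x\<close> for a maximal function may be attained
  or infinite.\<close>

lemma ennreal_mult_le_if_lessThan:
  fixes b c x :: ennreal
  assumes "\<And>t. 0 < t \<Longrightarrow> ennreal t < x \<Longrightarrow> ennreal t * b \<le> c"
  shows "x * b \<le> c"
proof (cases "x = 0")
  case False
  then have x: "0 < x" by (simp add: zero_less_iff_neq_zero)
  have "x = (SUP t\<in>{0<..<x}. t)"
  proof (rule antisym)
    show "x \<le> (SUP t\<in>{0<..<x}. t)"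
    proof (rule dense_le)
      fix z assume "z < x"
      then obtain y where y: "z < y" "y < x" using dense by blast
      then show "z \<le> (SUP t\<in>{0<..<x}. t)"
        using le_less_trans[OF zero_le y(1)] by (intro SUP_upper2[of y]) auto
    qed
    show "(SUP t\<in>{0<..<x}. t) \<le> x"
      by (rule SUP_least) (auto intro: less_imp_le)
  qed
  then have "x * b = (SUP t\<in>{0<..<x}. t) * b" by simp
  also have "\<dots> = (SUP t\<in>{0<..<x}. t * b)" by (rule SUP_mult_right_ennreal)
  also have "\<dots> \<le> c"
  proof (rule SUP_least)
    fix t assume t: "t \<in> {0<..<x}"
    then obtain r where "t = ennreal r" "0 < r"
      using le_less_trans[OF _ less_le_trans] by (cases t) (auto simp: top.not_eq_extremum)
    with t show "t * b \<le> c" using assms[of r] by auto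
  qed
  finally show ?thesis .
qed simp

text \<open>Young's inequality for the functions divided by their norms, whose product is
  \<open>c\<close>. If one norm vanishes, the product of the functions is zero almost everywhere, so
  the value $0 \<cdot> \<infinity> = 0$ on the right is still correct.\<close>

lemma nn_integral_Holder:
  fixes f g :: "'a \<Rightarrow> real"
  assumes pq: "1 < p" "1 < q" "1 / p + 1 / q = 1"
    and [measurable]: "f \<in> borel_measurable M" "g \<in> borel_measurable M"
    and nonneg: "\<And>x. 0 \<le> f x" "\<And>x. 0 \<le> g x"
  shows "(\<integral>\<^sup>+x. ennreal (f x * g x) \<partial>M)
     \<le> epowr (\<integral>\<^sup>+x. ennreal (f x powr p) \<partial>M) (1 / p) * epowr (\<integral>\<^sup>+x. ennreal (g x powr q) \<partial>M) (1 / q)"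
    (is "?L \<le> epowr ?F _ * epowr ?G _")
proof -
  have zero: "?L = 0" if "?F = 0 \<or> ?G = 0"
  proof -
    have "AE x in M. ennreal (f x powr p) = 0 \<or> ennreal (g x powr q) = 0"
      using that by (auto simp: nn_integral_0_iff_AE elim: eventually_mono)
    then have "AE x in M. ennreal (f x * g x) = 0"
      by eventually_elim (use nonneg in \<open>auto simp: ennreal_eq_0_iff\<close>)
    then show ?thesis by (subst nn_integral_0_iff_AE) auto
  qed
  show ?thesis
  proof (cases "?F = 0 \<or> ?G = 0 \<or> ?F = top \<or> ?G = top")
    case True
    with zero show ?thesis by (auto simp: ennreal_mult_top ennreal_top_mult)
  next
    case False
    obtain u v where u: "?F = ennreal u" "0 < u" and v: "?G = ennreal v" "0 < v"
      using False by (cases ?F; cases ?G) (auto simp: less_le)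
    define c where "c = u powr (1 / p) * v powr (1 / q)"
    have c: "0 < c" using u v by (simp add: c_def)
    have young: "f x * g x \<le> c / (p * u) * f x powr p + c / (q * v) * g x powr q" for x
    proof -
      have "f x * g x = c * ((f x / u powr (1 / p)) * (g x / v powr (1 / q)))"
        using u v by (simp add: c_def)
      also have "\<dots> \<le> c * ((f x / u powr (1 / p)) powr p / p + (g x / v powr (1 / q)) powr q / q)"
        using c pq nonneg u v by (intro mult_left_mono Youngs_inequality) auto
      also have "\<dots> = c / (p * u) * f x powr p + c / (q * v) * g x powr q"
        using u v pq nonneg by (simp add: powr_divide powr_powr field_simps)
      finally show ?thesis .
    qed
    have "?L \<le> (\<integral>\<^sup>+x. ennreal (c / (p * u)) * ennreal (f x powr p)
                   + ennreal (c / (q * v)) * ennreal (g x powr q) \<partial>M)"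
      using c u v pq young
      by (intro nn_integral_mono)
         (simp add: ennreal_mult[symmetric] ennreal_plus[symmetric] ennreal_leI del: ennreal_plus)
    also have "\<dots> = ennreal (c / (p * u)) * ?F + ennreal (c / (q * v)) * ?G"
      by (simp add: nn_integral_add nn_integral_cmult)
    also have "\<dots> = ennreal (c / (p * u) * u + c / (q * v) * v)"
      using c u v pq by (simp add: ennreal_mult[symmetric] ennreal_plus[symmetric] del: ennreal_plus)
    also have "c / (p * u) * u + c / (q * v) * v = c * (1 / p + 1 / q)"
      using u v pq by (simp add: field_simps)
    also have "ennreal (c * (1 / p + 1 / q)) = epowr ?F (1 / p) * epowr ?G (1 / q)"
      using u v pq by (simp add: c_def epowr_ennreal ennreal_mult)
    finally show ?thesis .
  qed
qed

section \<open>Cubes and superlevel sets of the maximal function\<close>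

text \<open>Pairs of corner and side index the cubes in the covering argument. In this form the
  concentric triple has corner \<open>a - l\<close> in each coordinate and side
  \<open>3 * l\<close>.\<close>

definition cube :: "real^'n \<Rightarrow> real \<Rightarrow> (real^'n) set" where
  "cube a l = cbox a (\<chi> i. a $ i + l)"

lemma mem_cube: "x \<in> cube a l \<longleftrightarrow> (\<forall>i. a $ i \<le> x $ i \<and> x $ i \<le> a $ i + l)"
  by (simp add: cube_def mem_box_cart)

lemma cube_in_cubes: "0 < l \<Longrightarrow> cube a l \<in> cubes"
  by (auto simp: cubes_def cube_def)

lemma cubesE:
  assumes "Q \<in> cubes"
  obtains a l where "0 < l" "Q = cube a l"
  using assms by (auto simp: cubes_def cube_def)

lemma sets_cube [measurable]: "cube a l \<in> sets borel" "cube a l \<in> sets lebesgue"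
  by (auto simp: cube_def)

lemma content_cube:
  assumes "0 < l"
  shows "measure lborel (cube (a :: real^'n) l) = l ^ CARD('n)"
proof -
  have "cube a l \<noteq> {}" using assms by (auto simp: cube_def interval_ne_empty_cart)
  then show ?thesis
    unfolding cube_def by (subst content_cbox_cart) auto
qed

lemma emeasure_cube:
  assumes "0 < l"
  shows "emeasure lborel (cube (a :: real^'n) l) = ennreal (l ^ CARD('n))"
proof -
  have "emeasure lborel (cube a l) = ennreal (measure lborel (cube a l))"
    unfolding cube_def by (rule emeasure_eq_ennreal_measure) (simp add: emeasure_lborel_cbox_eq)
  then show ?thesis using content_cube[OF assms, of a] by simp
qed

lemma cube_subset_triple: "0 < l \<Longrightarrow> cube a l \<subseteq> cube (\<chi> i. a $ i - l) (3 * l)"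
  by (auto simp: mem_cube) (smt (verit))+

lemma cube_subset_triple_of_meets:
  assumes "l \<le> k" "cube a l \<inter> cube b k \<noteq> {}"
  shows "cube a l \<subseteq> cube (\<chi> i. b $ i - k) (3 * k)"
proof
  fix x assume x: "x \<in> cube a l"
  obtain z where z: "z \<in> cube a l" "z \<in> cube b k" using assms by auto
  show "x \<in> cube (\<chi> i. b $ i - k) (3 * k)"
    unfolding mem_cube
  proof
    fix i
    have "a $ i \<le> x $ i \<and> x $ i \<le> a $ i + l" "a $ i \<le> z $ i \<and> z $ i \<le> a $ i + l"
      "b $ i \<le> z $ i \<and> z $ i \<le> b $ i + k" using x z by (simp_all add: mem_cube)
    then show "(\<chi> i. b $ i - k) $ i \<le> x $ i \<and> x $ i \<le> (\<chi> i. b $ i - k) $ i + 3 * k"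
      using assms(1) by auto
  qed
qed

text \<open>Greedy selection: a cube of largest side is chosen, every cube meeting it lies in its
  triple, and the induction continues with the cubes disjoint from it.\<close>

lemma Vitali_covering_cubes_finite:
  fixes F :: "((real^'n) \<times> real) set"
  assumes "finite F"
  obtains G where "G \<subseteq> F" "disjoint_family_on (\<lambda>(a, l). cube a l) G"
    "(\<Union>(a, l)\<in>F. cube a l) \<subseteq> (\<Union>(a, l)\<in>G. cube (\<chi> i. a $ i - l) (3 * l))"
proof -
  have "\<exists>G\<subseteq>F. disjoint_family_on (\<lambda>(a, l). cube a l) G \<and>
    (\<Union>(a, l)\<in>F. cube a l) \<subseteq> (\<Union>(a, l)\<in>G. cube (\<chi> i. a $ i - l) (3 * l))"
    using assms
  proof (induction F rule: finite_psubset_induct)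
    case (psubset F)
    show ?case
    proof (cases "F = {}")
      case False
      then have "Max (snd ` F) \<in> snd ` F" using psubset by (intro Max_in) auto
      then obtain b k where bk: "(b, k) \<in> F" "k = Max (snd ` F)" by auto
      have le: "l \<le> k" if "(a, l) \<in> F" for a l
        using psubset(1) that unfolding bk(2) by (intro Max_ge) force+
      \<comment> \<open>The chosen pair is removed explicitly: for a negative side its cube is
        empty, hence disjoint from itself, and \<open>F'\<close> would otherwise not be smaller than
        \<open>F\<close>.\<close>
      define F' where "F' = {(a, l)\<in>F. cube a l \<inter> cube b k = {}} - {(b, k)}"
      have "F' \<subset> F" using bk by (auto simp: F'_def)
      from psubset.IH[OF this] obtain G' where G': "G' \<subseteq> F'"
        "disjoint_family_on (\<lambda>(a, l). cube a l) G'"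
        "(\<Union>(a, l)\<in>F'. cube a l) \<subseteq> (\<Union>(a, l)\<in>G'. cube (\<chi> i. a $ i - l) (3 * l))"
        by blast
      have "disjoint_family_on (\<lambda>(a, l). cube a l) (insert (b, k) G')"
        using G'(1,2) by (subst disjoint_family_on_insert) (auto simp: F'_def)
      moreover have "(\<Union>(a, l)\<in>F. cube a l)
          \<subseteq> (\<Union>(a, l)\<in>insert (b, k) G'. cube (\<chi> i. a $ i - l) (3 * l))"
      proof safe
        fix x a l assume al: "(a, l) \<in> F" and x: "x \<in> cube a l"
        show "x \<in> (\<Union>(a, l)\<in>insert (b, k) G'. cube (\<chi> i. a $ i - l) (3 * l))"
        proof (cases "cube a l \<inter> cube b k = {} \<and> (a, l) \<noteq> (b, k)")
          case True
          then have "x \<in> (\<Union>(a, l)\<in>F'. cube a l)" using al x by (auto simp: F'_def)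
          then show ?thesis using G'(3) by auto
        next
          case False
          then have "cube a l \<inter> cube b k \<noteq> {}" using x by auto
          from cube_subset_triple_of_meets[OF le[OF al] this] x show ?thesis by auto
        qed
      qed
      moreover have "insert (b, k) G' \<subseteq> F" using G'(1) bk by (auto simp: F'_def)
      ultimately show ?thesis by blast
    qed (auto simp: disjoint_family_on_def)
  qed
  then show ?thesis using that by blast
qed

text \<open>Continuity from below along an enumeration; it carries the covering estimate from finite
  to countable families.\<close>

lemma emeasure_countable_Union_le:
  assumes "countable \<C>" "\<C> \<subseteq> sets M"
    and le: "\<And>\<D>. finite \<D> \<Longrightarrow> \<D> \<subseteq> \<C> \<Longrightarrow> emeasure M (\<Union>\<D>) \<le> c"
  shows "emeasure M (\<Union>\<C>) \<le> c"
proof (cases "\<C> = {}")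
  case False
  define A where "A n = (\<Union>i\<le>n. from_nat_into \<C> i)" for n
  have "(\<Union>n. A n) = (\<Union>i. from_nat_into \<C> i)" by (auto simp: A_def)
  then have "\<Union>\<C> = (\<Union>n. A n)"
    using range_from_nat_into[OF False assms(1)] by simp
  moreover have "emeasure M (\<Union>n. A n) = (SUP n. emeasure M (A n))"
  proof (rule SUP_emeasure_incseq[symmetric])
    have "from_nat_into \<C> i \<in> sets M" for i
      using from_nat_into[OF False, of i] assms(2) by auto
    then show "range A \<subseteq> sets M" by (auto simp: A_def)
    show "incseq A" unfolding A_def incseq_def by (auto intro: order_trans)
  qed
  moreover have "emeasure M (A n) \<le> c" for n
    unfolding A_def using from_nat_into[OF False] by (intro le) auto
  ultimately show ?thesis by (simp add: SUP_least)
qed simp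

lemma less_divide_ennreal_iff:
  assumes "0 < c"
  shows "ennreal t < x / ennreal c \<longleftrightarrow> ennreal (t * c) < x"
proof (cases x)
  case (real r)
  show ?thesis
  proof (cases "0 \<le> t")
    case True
    then show ?thesis using assms real by (simp add: divide_ennreal ennreal_less_iff field_simps)
  next
    case False
    then show ?thesis using assms real
      by (simp add: divide_ennreal ennreal_neg mult_nonpos_nonneg zero_less_divide_iff)
  qed
qed (use assms in \<open>simp add: ennreal_top_divide\<close>)

text \<open>A point on the boundary of an admissible cube is interior to a slightly larger
  concentric cube, which is still admissible because the defining inequality is strict. Hence open
  boxes suffice although the averages are over closed cubes.\<close>

lemma fractional_maximal_superlevel_eq:
  fixes f :: "real^'n \<Rightarrow> real"
  assumes "0 < s" "0 \<le> t" and s: "s = 1 - \<alpha> / real CARD('n)"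
  shows "{x. ennreal t < fractional_maximal \<alpha> f x}
    = \<Union>((\<lambda>(a, l). box a (\<chi> i. a $ i + l)) `
        {(a, l). 0 < l \<and> ennreal (t * (l ^ CARD('n)) powr s) < (\<integral>\<^sup>+y\<in>cube a l. ennreal \<bar>f y\<bar> \<partial>lebesgue)})"
    (is "?E = ?U")
proof -
  have E: "x \<in> ?E \<longleftrightarrow> (\<exists>a l. 0 < l \<and> x \<in> cube a l \<and>
      ennreal (t * (l ^ CARD('n)) powr s) < (\<integral>\<^sup>+y\<in>cube a l. ennreal \<bar>f y\<bar> \<partial>lebesgue))" for x
  proof -
    have "x \<in> ?E \<longleftrightarrow> (\<exists>Q\<in>{Q \<in> cubes. x \<in> Q}. ennreal t <
        (\<integral>\<^sup>+y\<in>Q. ennreal \<bar>f y\<bar> \<partial>lebesgue) / ennreal (measure lebesgue Q powr s))"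
      by (simp add: fractional_maximal_def less_SUP_iff s)
    also have "\<dots> \<longleftrightarrow> (\<exists>a l. 0 < l \<and> x \<in> cube a l \<and> ennreal t <
        (\<integral>\<^sup>+y\<in>cube a l. ennreal \<bar>f y\<bar> \<partial>lebesgue) / ennreal (measure lebesgue (cube a l) powr s))"
      by (auto elim!: cubesE intro: cube_in_cubes) blast
    also have "\<dots> \<longleftrightarrow> (\<exists>a l. 0 < l \<and> x \<in> cube a l \<and>
      ennreal (t * (l ^ CARD('n)) powr s) < (\<integral>\<^sup>+y\<in>cube a l. ennreal \<bar>f y\<bar> \<partial>lebesgue))"
      by (intro ex_cong1 conj_cong refl) (simp add: content_cube less_divide_ennreal_iff)
    finally show ?thesis .
  qed
  show ?thesis
  proof (intro set_eqI iffI)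
    fix x assume "x \<in> ?U"
    then obtain a l where "0 < l" "x \<in> box a (\<chi> i. a $ i + l)"
      "ennreal (t * (l ^ CARD('n)) powr s) < (\<integral>\<^sup>+y\<in>cube a l. ennreal \<bar>f y\<bar> \<partial>lebesgue)"
      by auto
    moreover from this(2) have "x \<in> cube a l" using box_subset_cbox by (auto simp: cube_def)
    ultimately show "x \<in> ?E" unfolding E by blast
  next
    fix x assume "x \<in> ?E"
    then obtain a l where l: "0 < l" and x: "x \<in> cube a l" and
      less: "ennreal (t * (l ^ CARD('n)) powr s) < (\<integral>\<^sup>+y\<in>cube a l. ennreal \<bar>f y\<bar> \<partial>lebesgue)"
      unfolding E by auto
    \<comment> \<open>The threshold is continuous in the enlargement \<open>e\<close>, and the
      integral over the larger cube is not smaller, so some positive \<open>e\<close> preserves the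
      inequality.\<close>
    have "((\<lambda>e. ennreal (t * ((l + 2 * e) ^ CARD('n)) powr s)) \<longlongrightarrow>
        ennreal (t * ((l + 2 * 0) ^ CARD('n)) powr s)) (at_right 0)"
      using l by (intro tendsto_intros) auto
    then have "\<forall>\<^sub>F e in at_right 0. ennreal (t * ((l + 2 * e) ^ CARD('n)) powr s)
        < (\<integral>\<^sup>+y\<in>cube a l. ennreal \<bar>f y\<bar> \<partial>lebesgue)"
      using less by (intro order_tendstoD) auto
    then obtain e where e: "0 < e" "ennreal (t * ((l + 2 * e) ^ CARD('n)) powr s)
        < (\<integral>\<^sup>+y\<in>cube a l. ennreal \<bar>f y\<bar> \<partial>lebesgue)"
      by (metis (mono_tags, lifting) eventually_at_right_field field_lbound_gt_zero eventually_happens' trivial_limit_at_right_real eventually_at_right_less)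
    define a' where "a' = (\<chi> i. a $ i - e)"
    have "cube a l \<subseteq> cube a' (l + 2 * e)"
      using e by (auto simp: mem_cube a'_def) (smt (verit))+
    then have "(\<integral>\<^sup>+y\<in>cube a l. ennreal \<bar>f y\<bar> \<partial>lebesgue) \<le> (\<integral>\<^sup>+y\<in>cube a' (l + 2 * e). ennreal \<bar>f y\<bar> \<partial>lebesgue)"
      by (intro nn_integral_mono) (auto simp: indicator_def)
    moreover have "x \<in> box a' (\<chi> i. a' $ i + (l + 2 * e))"
      using x e by (auto simp: mem_cube a'_def mem_box_cart) (smt (verit))+
    ultimately show "x \<in> ?U"
      using l e by (intro UnionI[of "box a' (\<chi> i. a' $ i + (l + 2 * e))"] image_eqI[of _ _ "(a', l + 2 * e)"]) auto
  qed
qed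

lemma open_fractional_maximal_superlevel:
  fixes f :: "real^'n \<Rightarrow> real"
  assumes "\<alpha> < real CARD('n)" "0 \<le> t"
  shows "open {x. ennreal t < fractional_maximal \<alpha> f x}"
proof -
  have "0 < 1 - \<alpha> / real CARD('n)" using assms by (simp add: field_simps)
  then show ?thesis
    by (subst fractional_maximal_superlevel_eq[OF _ assms(2) refl]) auto
qed

section \<open>Duality for the weight condition\<close>

text \<open>Local integrability gives measurability on balls only; these exhaust the space.\<close>

lemma weight_measurable:
  fixes w :: "real^'n \<Rightarrow> real"
  assumes "weight w"
  shows "w \<in> borel_measurable lebesgue"
proof (rule borel_measurable_LIMSEQ_real)
  fix x :: "real^'n"
  have "\<forall>\<^sub>F n in sequentially. indicator (cball 0 (real n)) x *\<^sub>R w x = w x"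
    using eventually_ge_at_top[of "nat \<lceil>norm x\<rceil>"]
    by eventually_elim (simp add: indicator_def)
  then show "(\<lambda>n. indicator (cball 0 (real n)) x *\<^sub>R w x) \<longlonglongrightarrow> w x"
    by (rule tendsto_eventually)
next
  fix n
  have "set_integrable lebesgue (cball 0 (real n)) w"
    using assms by (simp add: weight_def)
  then show "(\<lambda>x. indicator (cball 0 (real n)) x *\<^sub>R w x) \<in> borel_measurable lebesgue"
    unfolding set_integrable_def by (rule borel_measurable_integrable)
qed

text \<open>This is the quantity $N(Q)$ of the overview.\<close>

definition dual_factor :: "real \<Rightarrow> (real^'n \<Rightarrow> real) \<Rightarrow> (real^'n) set \<Rightarrow> ennreal" where
  "dual_factor p w Q =
    (if p = 1 then esssup (lebesgue_on Q) (\<lambda>x. inverse (ennreal (w x)))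
     else let p' = conjugate_exponent p
          in epowr (average Q (\<lambda>x. epowr (inverse (ennreal (w x))) p')) (1 / p'))"

lemma A_const_eq:
  "A_const A p q w =
     (SUP Q\<in>cubes. epowr (average Q (\<lambda>x. ennreal (w (A *v x) powr q))) (1 / q) * dual_factor p w Q)"
  by (simp add: A_const_def dual_factor_def)

lemma conjugate_exponent_bounds:
  assumes "1 < p"
  shows "1 < conjugate_exponent p" "1 / conjugate_exponent p = 1 - 1 / p"
  using assms by (simp_all add: conjugate_exponent_def field_simps)

lemma epowr_average:
  assumes "emeasure lebesgue Q = ennreal V" "0 < V"
  shows "ennreal (V powr s) * epowr (average Q g) s = epowr (\<integral>\<^sup>+x\<in>Q. g x \<partial>lebesgue) s"
proof -
  have "ennreal (V powr s) * epowr (average Q g) s = epowr (ennreal V * average Q g) s"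
    using assms by (simp add: epowr_mult epowr_ennreal)
  also have "ennreal V * average Q g = (\<integral>\<^sup>+x\<in>Q. g x \<partial>lebesgue)"
    using assms unfolding average_def
    by (simp add: ennreal_times_divide mult.commute[of "ennreal V"] ennreal_mult_divide_eq)
  finally show ?thesis .
qed

text \<open>Hoelder's inequality for $|f| w$ and $w^{-1}$. Finiteness of the dual factor forces $w >
  0$ almost everywhere on \<open>Q\<close>, so that $|f| = |f| w w^{-1}$ there. Integrating over a
  smaller set \<open>S\<close> while keeping the dual factor of \<open>Q\<close> is what later
  allows a cube and its triple to be combined.\<close>

lemma nn_integral_le_dual_factor:
  fixes w f :: "real^'n \<Rightarrow> real"
  assumes p: "1 \<le> p" and [measurable]: "w \<in> borel_measurable lebesgue" "f \<in> borel_measurable lebesgue"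
    and nonneg: "\<And>x. 0 \<le> w x"
    and [measurable]: "S \<in> sets lebesgue" "Q \<in> sets lebesgue" and "S \<subseteq> Q"
    and V: "emeasure lebesgue Q = ennreal V" "0 < V"
    and fin: "dual_factor p w Q < \<infinity>"
  shows "(\<integral>\<^sup>+x\<in>S. ennreal \<bar>f x\<bar> \<partial>lebesgue)
    \<le> epowr (\<integral>\<^sup>+x\<in>S. ennreal ((\<bar>f x\<bar> * w x) powr p) \<partial>lebesgue) (1 / p)
      * (ennreal (V powr (1 - 1 / p)) * dual_factor p w Q)"
proof (cases "p = 1")
  case True
  define D where "D = dual_factor p w Q"
  have "AE x in lebesgue_on Q. inverse (ennreal (w x)) \<le> D"
    unfolding D_def dual_factor_def True by (simp add: esssup_AE)
  then have "AE x in lebesgue. x \<in> Q \<longrightarrow> inverse (ennreal (w x)) \<le> D"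
    by (simp add: AE_restrict_space_iff)
  then have "AE x in lebesgue. ennreal \<bar>f x\<bar> * indicator S x
      \<le> ennreal ((\<bar>f x\<bar> * w x) powr p) * indicator S x * D"
  proof eventually_elim
    fix x assume x: "x \<in> Q \<longrightarrow> inverse (ennreal (w x)) \<le> D"
    show "ennreal \<bar>f x\<bar> * indicator S x \<le> ennreal ((\<bar>f x\<bar> * w x) powr p) * indicator S x * D"
    proof (cases "x \<in> S")
      case xS: True
      then have D: "inverse (ennreal (w x)) \<le> D" using x \<open>S \<subseteq> Q\<close> by auto
      then have w: "0 < w x"
        using fin nonneg[of x] by (cases "w x = 0") (auto simp: D_def top_unique)
      have "ennreal \<bar>f x\<bar> = ennreal (\<bar>f x\<bar> * w x) * inverse (ennreal (w x))"
        using w by (simp add: inverse_ennreal ennreal_mult[symmetric])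
      also have "\<dots> \<le> ennreal (\<bar>f x\<bar> * w x) * D"
        using D by (rule mult_left_mono) simp
      finally show ?thesis using xS w True by simp
    qed simp
  qed
  then have "(\<integral>\<^sup>+x\<in>S. ennreal \<bar>f x\<bar> \<partial>lebesgue)
      \<le> (\<integral>\<^sup>+x. ennreal ((\<bar>f x\<bar> * w x) powr p) * indicator S x * D \<partial>lebesgue)"
    by (rule nn_integral_mono_AE)
  then show ?thesis
    using V by (simp add: nn_integral_multc D_def True)
next
  case False
  then have p1: "1 < p" using p by simp
  define r where "r = conjugate_exponent p"
  note r = conjugate_exponent_bounds[OF p1, folded r_def]
  define J where "J = (\<integral>\<^sup>+x\<in>Q. epowr (inverse (ennreal (w x))) r \<partial>lebesgue)"
  have D: "ennreal (V powr (1 - 1 / p)) * dual_factor p w Q = epowr J (1 / r)"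
    using epowr_average[OF V, of "1 / r"] False r
    by (simp add: dual_factor_def J_def r_def Let_def)
  moreover have "ennreal (V powr (1 - 1 / p)) * dual_factor p w Q < top"
    using fin by (simp add: ennreal_mult_less_top)
  ultimately have "J \<noteq> top" by auto
  then have "AE x in lebesgue. epowr (inverse (ennreal (w x))) r * indicator Q x \<noteq> \<infinity>"
    unfolding J_def by (intro nn_integral_PInf_AE) auto
  then have pos: "AE x in lebesgue. x \<in> S \<longrightarrow> 0 < w x"
    by eventually_elim (use nonneg \<open>S \<subseteq> Q\<close> in \<open>auto simp: less_le\<close>)
  have "(\<integral>\<^sup>+x\<in>S. ennreal \<bar>f x\<bar> \<partial>lebesgue)
     = (\<integral>\<^sup>+x. ennreal ((\<bar>f x\<bar> * w x * indicator S x) * (inverse (w x) * indicator S x)) \<partial>lebesgue)"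
    using pos by (intro nn_integral_cong_AE) (auto simp: indicator_def elim!: eventually_mono)
  also have "\<dots> \<le> epowr (\<integral>\<^sup>+x. ennreal ((\<bar>f x\<bar> * w x * indicator S x) powr p) \<partial>lebesgue) (1 / p)
      * epowr (\<integral>\<^sup>+x. ennreal ((inverse (w x) * indicator S x) powr r) \<partial>lebesgue) (1 / r)"
    using p1 r nonneg by (intro nn_integral_Holder) auto
  also have "(\<integral>\<^sup>+x. ennreal ((\<bar>f x\<bar> * w x * indicator S x) powr p) \<partial>lebesgue)
      = (\<integral>\<^sup>+x\<in>S. ennreal ((\<bar>f x\<bar> * w x) powr p) \<partial>lebesgue)"
    by (intro nn_integral_cong) (auto simp: indicator_def)
  also have "(\<integral>\<^sup>+x. ennreal ((inverse (w x) * indicator S x) powr r) \<partial>lebesgue) \<le> J"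
    unfolding J_def
  proof (rule nn_integral_mono)
    fix x
    show "ennreal ((inverse (w x) * indicator S x) powr r)
        \<le> epowr (inverse (ennreal (w x))) r * indicator Q x"
      using \<open>S \<subseteq> Q\<close> nonneg[of x]
      by (cases "w x = 0") (auto simp: indicator_def inverse_ennreal epowr_ennreal less_le)
  qed
  finally show ?thesis
    using r(1) unfolding D by (simp add: epowr_mono mult_left_mono)
qed

text \<open>The extremal functions are indicators of \<open>{x \<in> Q. w x < s}\<close> for \<open>p = 1\<close>, and the
  truncations \<open>max (w x) (1 / k) powr - p'\<close> for \<open>p > 1\<close>. The latter are integrable on \<open>Q\<close> even when
  \<open>w\<close> vanishes on a set of positive measure, so this case needs no separate treatment.\<close>

lemma dual_factor_le:
  fixes w :: "real^'n \<Rightarrow> real"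
  assumes p: "1 \<le> p" and [measurable]: "w \<in> borel_measurable lebesgue"
    and nonneg: "\<And>x. 0 \<le> w x"
    and [measurable]: "Q \<in> sets lebesgue"
    and V: "emeasure lebesgue Q = ennreal V" "0 < V" and c: "0 < c"
    and le: "\<And>f. f \<in> borel_measurable lebesgue \<Longrightarrow>
      b * (\<integral>\<^sup>+x\<in>Q. ennreal \<bar>f x\<bar> \<partial>lebesgue)
        \<le> ennreal c * epowr (\<integral>\<^sup>+x\<in>Q. ennreal ((\<bar>f x\<bar> * w x) powr p) \<partial>lebesgue) (1 / p)"
  shows "b * (ennreal (V powr (1 - 1 / p)) * dual_factor p w Q) \<le> ennreal c"
proof (cases "p = 1")
  case True
  have null: "emeasure lebesgue {x\<in>Q. w x < s} = 0" if s: "0 < s" "ennreal (c * s) < b" for s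
  proof (rule ccontr)
    define E where "E = {x\<in>Q. w x < s}"
    assume "emeasure lebesgue {x\<in>Q. w x < s} \<noteq> 0"
    then have E0: "emeasure lebesgue E \<noteq> 0" by (simp add: E_def)
    have [measurable]: "E \<in> sets lebesgue"
    proof -
      have "E = Q \<inter> {x\<in>space lebesgue. w x < s}" by (auto simp: E_def)
      also have "\<dots> \<in> sets lebesgue" by measurable
      finally show ?thesis .
    qed
    have "emeasure lebesgue E \<le> ennreal V"
      unfolding V(1)[symmetric] by (rule emeasure_mono) (auto simp: E_def)
    then obtain e where e: "emeasure lebesgue E = ennreal e" "0 < e"
      using E0 by (cases "emeasure lebesgue E") (auto simp: less_le top_unique)
    have "b * ennreal e = b * (\<integral>\<^sup>+x\<in>Q. ennreal \<bar>indicat_real E x\<bar> \<partial>lebesgue)"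
    proof -
      have "(\<integral>\<^sup>+x\<in>Q. ennreal \<bar>indicat_real E x\<bar> \<partial>lebesgue) = (\<integral>\<^sup>+x. indicator E x \<partial>lebesgue)"
        by (intro nn_integral_cong) (auto simp: indicator_def E_def)
      then show ?thesis using e by simp
    qed
    also have "\<dots> \<le> ennreal c * epowr (\<integral>\<^sup>+x\<in>Q. ennreal ((\<bar>indicat_real E x\<bar> * w x) powr p) \<partial>lebesgue) (1 / p)"
      by (rule le) measurable
    also have "\<dots> = ennreal c * (\<integral>\<^sup>+x\<in>Q. ennreal ((\<bar>indicat_real E x\<bar> * w x) powr p) \<partial>lebesgue)"
      by (simp add: True)
    also have "\<dots> \<le> ennreal c * (\<integral>\<^sup>+x. ennreal s * indicator E x \<partial>lebesgue)"
      using nonneg s by (intro mult_left_mono nn_integral_mono)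
        (auto simp: indicator_def E_def True intro!: ennreal_leI)
    also have "\<dots> = ennreal (c * s) * ennreal e"
      using c s e by (simp add: nn_integral_cmult ennreal_mult mult.assoc)
    finally have "b * ennreal e \<le> ennreal (c * s) * ennreal e" .
    then have "b \<le> ennreal (c * s)"
      using e(2) c s
      by (cases b) (auto simp: ennreal_mult[symmetric] ennreal_top_mult top_unique)
    with s(2) show False by simp
  qed
  \<comment> \<open>Rational levels leave only countably many null sets to discard; by density they
    still yield $b \<le> c w$ almost everywhere on \<open>Q\<close>.\<close>
  have "AE x in lebesgue. \<forall>s\<in>{s\<in>\<rat>. 0 < s \<and> ennreal (c * s) < b}. x \<in> Q \<longrightarrow> s \<le> w x"
  proof (subst AE_ball_countable)
    show "countable {s\<in>\<rat>. 0 < s \<and> ennreal (c * s) < b}"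
      by (rule countable_subset[OF _ countable_rat]) auto
    show "\<forall>s\<in>{s\<in>\<rat>. 0 < s \<and> ennreal (c * s) < b}. AE x in lebesgue. x \<in> Q \<longrightarrow> s \<le> w x"
    proof
      fix s assume s: "s \<in> {s\<in>\<rat>. 0 < s \<and> ennreal (c * s) < b}"
      have "{x\<in>Q. w x < s} = Q \<inter> {x\<in>space lebesgue. w x < s}" by auto
      also have "\<dots> \<in> sets lebesgue" by measurable
      finally have "{x\<in>Q. w x < s} \<in> null_sets lebesgue"
        using null[of s] s by (auto simp: null_sets_def)
      then have "AE x in lebesgue. x \<notin> {x\<in>Q. w x < s}" by (rule AE_not_in)
      then show "AE x in lebesgue. x \<in> Q \<longrightarrow> s \<le> w x"
        by eventually_elim auto
    qed
  qed
  then have b_le: "AE x in lebesgue. x \<in> Q \<longrightarrow> b \<le> ennreal (c * w x)"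
  proof eventually_elim
    fix x assume x: "\<forall>s\<in>{s\<in>\<rat>. 0 < s \<and> ennreal (c * s) < b}. x \<in> Q \<longrightarrow> s \<le> w x"
    show "x \<in> Q \<longrightarrow> b \<le> ennreal (c * w x)"
    proof (rule impI, rule ccontr)
      assume xQ: "x \<in> Q" and "\<not> b \<le> ennreal (c * w x)"
      then obtain y where y: "ennreal (c * w x) < y" "y < b"
        using dense[of "ennreal (c * w x)" b] by (auto simp: not_le)
      then obtain y' where y': "y = ennreal y'" "0 \<le> y'" by (cases y) auto
      then have "w x < y' / c" using y(1) c nonneg[of x] by (simp add: ennreal_less_iff field_simps)
      then obtain s where s: "s \<in> \<rat>" "w x < s" "s < y' / c" using Rats_dense_in_real[of "w x" "y' / c"] by auto
      have "ennreal (c * s) \<le> y" using s(3) c y' by (auto simp: field_simps intro!: ennreal_leI)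
      then have "ennreal (c * s) < b" using y(2) by (rule le_less_trans)
      then have "s \<le> w x" using x xQ s nonneg[of x] by auto
      with s(2) show False by simp
    qed
  qed
  have "b \<noteq> top"
  proof
    assume "b = top"
    then have "AE x in lebesgue. x \<notin> Q" using b_le by (auto simp: top_unique)
    then have "emeasure lebesgue Q = 0" by (subst (asm) AE_iff_null_sets[symmetric]) auto
    with V show False by simp
  qed
  show ?thesis
  proof (cases "b = 0")
    case b0: False
    with \<open>b \<noteq> top\<close> obtain b' where b': "b = ennreal b'" "0 < b'"
      by (cases b) (auto simp: less_le)
    have "esssup (lebesgue_on Q) (\<lambda>x. inverse (ennreal (w x))) \<le> ennreal (c / b')"
    proof (rule esssup_I)
      show "(\<lambda>x. inverse (ennreal (w x))) \<in> borel_measurable (lebesgue_on Q)"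
        by (rule measurable_restrict_space1) measurable
      have "AE x in lebesgue. x \<in> Q \<longrightarrow> inverse (ennreal (w x)) \<le> ennreal (c / b')"
        using b_le
      proof eventually_elim
        fix x assume x: "x \<in> Q \<longrightarrow> b \<le> ennreal (c * w x)"
        show "x \<in> Q \<longrightarrow> inverse (ennreal (w x)) \<le> ennreal (c / b')"
        proof
          assume "x \<in> Q"
          with x have "b' \<le> c * w x" using b' nonneg[of x] c by simp
          moreover from this have "0 < w x" using b'(2) c
            by (metis less_le_trans zero_less_mult_pos)
          ultimately show "inverse (ennreal (w x)) \<le> ennreal (c / b')"
            using b'(2) c by (simp add: inverse_ennreal ennreal_leI field_simps)
        qed
      qed
      then show "AE x in lebesgue_on Q. inverse (ennreal (w x)) \<le> ennreal (c / b')"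
        by (simp add: AE_restrict_space_iff)
    qed
    then have "b * dual_factor p w Q \<le> b * ennreal (c / b')"
      by (simp add: dual_factor_def True mult_left_mono)
    also have "\<dots> = ennreal c" using b' c by (simp add: ennreal_mult[symmetric])
    finally show ?thesis using V by (simp add: True)
  qed simp
next
  case False
  then have p1: "1 < p" using p by simp
  define r where "r = conjugate_exponent p"
  note r = conjugate_exponent_bounds[OF p1, folded r_def]
  \<comment> \<open>This identity makes the test functions reproduce themselves: since $w \<le>
    m_k$, the weighted $p$-th power of \<open>m k x powr - r\<close> is at most
    \<open>m k x powr (p - p * r)\<close>, the test function again. So \<open>b * I k\<close> is
    bounded by \<open>c\<close> times the $1/p$-th power of \<open>I k\<close>.\<close>
  have pr: "p - p * r = - r" using p1 by (simp add: r_def conjugate_exponent_def field_simps)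
  define J where "J = (\<integral>\<^sup>+x\<in>Q. epowr (inverse (ennreal (w x))) r \<partial>lebesgue)"
  define m where "m k x = max (w x) (1 / real (Suc k))" for k x
  define I where "I k = (\<integral>\<^sup>+x\<in>Q. ennreal (m k x powr - r) \<partial>lebesgue)" for k
  have m_pos: "0 < m k x" for k x by (simp add: m_def less_max_iff_disj)
  have [measurable]: "m k \<in> borel_measurable lebesgue" for k unfolding m_def by measurable
  have I: "epowr b r * I k \<le> epowr (ennreal c) r" for k
  proof (cases "I k = 0")
    case I0: False
    \<comment> \<open>The positive lower bound of \<open>m k\<close> and the finite volume of
      \<open>Q\<close> make \<open>I k\<close> finite, which permits division by its $1/p$-th
      power.\<close>
    have "I k \<le> (\<integral>\<^sup>+x. ennreal ((1 / real (Suc k)) powr - r) * indicator Q x \<partial>lebesgue)"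
      unfolding I_def
    proof (intro nn_integral_mono mult_right_mono ennreal_leI)
      fix x
      show "m k x powr - r \<le> (1 / real (Suc k)) powr - r"
        using r(1) by (intro powr_mono2') (auto simp: m_def)
    qed simp
    also have "\<dots> < top" using V by (simp add: nn_integral_cmult ennreal_mult_less_top)
    finally obtain u where u: "I k = ennreal u" "0 < u"
      using I0 by (cases "I k") (auto simp: less_le)
    have "b * I k = b * (\<integral>\<^sup>+x\<in>Q. ennreal \<bar>m k x powr - r\<bar> \<partial>lebesgue)"
      by (simp add: I_def)
    also have "\<dots> \<le> ennreal c * epowr (\<integral>\<^sup>+x\<in>Q. ennreal ((\<bar>m k x powr - r\<bar> * w x) powr p) \<partial>lebesgue) (1 / p)"
      by (rule le) measurable
    also have "\<dots> \<le> ennreal c * epowr (I k) (1 / p)"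
      unfolding I_def
    proof (intro mult_left_mono epowr_mono nn_integral_mono mult_right_mono ennreal_leI)
      fix x
      have "(\<bar>m k x powr - r\<bar> * w x) powr p \<le> (m k x powr - r * m k x) powr p"
        using nonneg p1 by (intro powr_mono2 mult_mono) (auto simp: m_def)
      also have "\<dots> = m k x powr (p - p * r)"
        using m_pos[of k x] by (simp add: powr_mult powr_powr powr_add[symmetric] algebra_simps)
      finally show "(\<bar>m k x powr - r\<bar> * w x) powr p \<le> m k x powr - r" by (simp add: pr)
    qed (use p in auto)
    finally have *: "b * ennreal u \<le> ennreal (c * u powr (1 / p))"
      using u c by (simp add: epowr_ennreal ennreal_mult)
    then have "b \<noteq> top" using u by (auto simp: ennreal_top_mult top_unique)
    then obtain b' where b': "b = ennreal b'" "0 \<le> b'" by (cases b) auto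
    have "u powr (1 / p) * u powr (1 / r) = u"
      using u r by (simp add: powr_add[symmetric])
    then have "u powr (1 / p) * (b' * u powr (1 / r)) \<le> u powr (1 / p) * c"
      using * b' u c by (simp add: ennreal_mult[symmetric] mult.commute mult.left_commute)
    then have "b' * u powr (1 / r) \<le> c" using u by simp
    then have "(b' * u powr (1 / r)) powr r \<le> c powr r"
      using b' r by (intro powr_mono2) auto
    moreover have "(b' * u powr (1 / r)) powr r = b' powr r * u"
      using b' u r(1) by (simp add: powr_mult powr_powr)
    ultimately show ?thesis
      using b' u c by (simp add: epowr_ennreal ennreal_mult[symmetric] ennreal_leI)
  qed simp
  have m_mono: "m k x powr - r \<le> m k' x powr - r" if "k \<le> k'" for k k' x
  proof (rule powr_mono2')
    have "1 / real (Suc k') \<le> 1 / real (Suc k)" using that by (intro divide_left_mono) auto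
    then show "m k' x \<le> m k x" by (auto simp: m_def)
  qed (use r m_pos in auto)
  have J_eq: "J = (SUP k. I k)"
  proof -
    \<comment> \<open>Where \<open>w\<close> is positive the truncations are eventually constant.
      Where it vanishes they equal \<open>real (Suc k) powr r\<close> and tend to infinity, in
      agreement with the extended inverse.\<close>
    have "(SUP k. ennreal (m k x powr - r) * indicator Q x)
        = epowr (inverse (ennreal (w x))) r * indicator Q x" for x
    proof (rule LIMSEQ_unique[OF LIMSEQ_SUP])
      show "incseq (\<lambda>k. ennreal (m k x powr - r) * indicator Q x)"
        unfolding incseq_def using m_mono by (auto intro!: mult_right_mono ennreal_leI)
      show "(\<lambda>k. ennreal (m k x powr - r) * indicator Q x)
          \<longlonglongrightarrow> epowr (inverse (ennreal (w x))) r * indicator Q x"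
      proof (cases "w x = 0")
        case w0: False
        then have w: "0 < w x" using nonneg[of x] by simp
        have "\<forall>\<^sub>F k in sequentially. 1 / real (Suc k) < w x"
          using order_tendstoD(2)[OF LIMSEQ_inverse_real_of_nat w] by (simp add: inverse_eq_divide)
        then have "\<forall>\<^sub>F k in sequentially. ennreal (m k x powr - r) * indicator Q x
            = epowr (inverse (ennreal (w x))) r * indicator Q x"
          by eventually_elim
            (use w in \<open>simp add: m_def max_def inverse_ennreal epowr_ennreal powr_minus inverse_powr\<close>)
        then show ?thesis by (rule tendsto_eventually)
      next
        case True
        have "filterlim (\<lambda>k. real (Suc k)) at_top sequentially"
          by (rule filterlim_compose[OF filterlim_real_sequentially filterlim_Suc])
        moreover have "real (Suc k) \<le> real (Suc k) powr r" for k
          using powr_mono[of 1 r "real (Suc k)"] r(1) by simp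
        ultimately have "filterlim (\<lambda>k. real (Suc k) powr r) at_top sequentially"
          by (auto intro: filterlim_at_top_mono)
        then have "(\<lambda>k. ennreal (real (Suc k) powr r)) \<longlonglongrightarrow> top"
          by (simp add: ennreal_tendsto_top_eq_at_top)
        moreover have "m k x powr - r = real (Suc k) powr r" for k
          by (simp add: m_def True max_def powr_minus powr_divide)
        ultimately show ?thesis
          using True by (cases "x \<in> Q") auto
      qed
    qed
    then have "J = (\<integral>\<^sup>+x. (SUP k. ennreal (m k x powr - r) * indicator Q x) \<partial>lebesgue)"
      by (simp add: J_def)
    also have "\<dots> = (SUP k. I k)"
      unfolding I_def
    proof (rule nn_integral_monotone_convergence_SUP)
      show "incseq (\<lambda>k x. ennreal (m k x powr - r) * indicator Q x)"
        unfolding incseq_def le_fun_def using m_mono by (auto intro!: mult_right_mono ennreal_leI)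
    qed measurable
    finally show ?thesis .
  qed
  have "epowr b r * J = (SUP k. epowr b r * I k)"
    unfolding J_eq by (rule SUP_mult_left_ennreal)
  also have "\<dots> \<le> epowr (ennreal c) r" by (rule SUP_least) (rule I)
  finally have "epowr (b * epowr J (1 / r)) r \<le> epowr (ennreal c) r"
    using r(1) by (simp add: epowr_mult epowr_epowr)
  then have "b * epowr J (1 / r) \<le> ennreal c"
    using r(1) by (simp add: epowr_le_iff)
  moreover have "ennreal (V powr (1 - 1 / p)) * dual_factor p w Q = epowr J (1 / r)"
    using epowr_average[OF V, of "1 / r"] False r
    by (simp add: dual_factor_def J_def r_def Let_def)
  ultimately show ?thesis by simp
qed

section \<open>The weak-type inequality\<close>

lemma invertible_matrix_inv:
  fixes A :: "'a::semiring_1^'n^'m"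
  assumes "invertible A"
  shows "A ** matrix_inv A = mat 1" "matrix_inv A ** A = mat 1"
  using someI_ex[OF assms[unfolded invertible_def]] by (auto simp: matrix_inv_def)

lemma Lp_norm_weighted_measure:
  assumes [measurable]: "w \<in> borel_measurable lebesgue" "f \<in> borel_measurable lebesgue"
    and nonneg: "\<And>x. 0 \<le> w x"
  shows "Lp_norm (weighted_measure (\<lambda>x. w x powr p)) p f
    = epowr (\<integral>\<^sup>+x. ennreal ((\<bar>f x\<bar> * w x) powr p) \<partial>lebesgue) (1 / p)"
  unfolding Lp_norm_def weighted_measure_def
  by (subst nn_integral_density)
     (auto simp: nonneg powr_mult ennreal_mult[symmetric] mult.commute)

lemma borel_measurable_weighted_measure:
  "borel_measurable (weighted_measure v) = borel_measurable lebesgue"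
  by (rule measurable_cong_sets) (simp_all add: weighted_measure_def)

text \<open>If the dual factor of the large cube is infinite, finiteness of the constant forces \<open>w \<circ> A\<close> to
  vanish almost everywhere on that cube; this is the case in which \<open>0 \<cdot> \<infinity> = 0\<close> matters.\<close>

lemma cube_mult_epowr_le_A_const:
  fixes A :: "real^'n^'n" and w f :: "real^'n \<Rightarrow> real"
  assumes p: "1 \<le> p" and q: "0 < q"
    and [measurable]: "w \<in> borel_measurable lebesgue" "f \<in> borel_measurable lebesgue"
    and nonneg: "\<And>x. 0 \<le> w x"
    and "A_const A p q w < \<infinity>" "0 < l" and sub: "cube b k \<subseteq> cube a l"
  defines "V \<equiv> l ^ CARD('n)"
  shows "(\<integral>\<^sup>+x\<in>cube b k. ennreal \<bar>f x\<bar> \<partial>lebesgue)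
      * epowr (\<integral>\<^sup>+x\<in>cube a l. ennreal (w (A *v x) powr q) \<partial>lebesgue) (1 / q)
    \<le> ennreal (V powr (1 / q + 1 - 1 / p)) * A_const A p q w
      * epowr (\<integral>\<^sup>+x\<in>cube b k. ennreal ((\<bar>f x\<bar> * w x) powr p) \<partial>lebesgue) (1 / p)"
    (is "?F * ?B \<le> _ * ?K * ?X")
proof (cases "?B = 0")
  case False
  define D where "D = dual_factor p w (cube a l)"
  define R where "R = epowr (average (cube a l) (\<lambda>x. ennreal (w (A *v x) powr q))) (1 / q)"
  have V: "emeasure lebesgue (cube a l) = ennreal V" "0 < V"
    using emeasure_cube[OF \<open>0 < l\<close>, of a] \<open>0 < l\<close> by (simp_all add: V_def)
  have B: "?B = ennreal (V powr (1 / q)) * R"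
    unfolding R_def by (rule epowr_average[OF V, symmetric])
  have RD: "R * D \<le> ?K"
    unfolding A_const_eq R_def D_def by (rule SUP_upper) (rule cube_in_cubes[OF \<open>0 < l\<close>])
  have "R \<noteq> 0" using False B by auto
  have "D < \<infinity>"
  proof (rule ccontr)
    assume "\<not> D < \<infinity>"
    then have "R * D = top" using \<open>R \<noteq> 0\<close> by (simp add: less_top[symmetric] ennreal_mult_top)
    with RD \<open>?K < \<infinity>\<close> show False by (simp add: top_unique)
  qed
  then have "?F \<le> ?X * (ennreal (V powr (1 - 1 / p)) * D)"
    unfolding D_def using p nonneg sub V by (intro nn_integral_le_dual_factor) auto
  then have "?F * ?B \<le> ?X * (ennreal (V powr (1 - 1 / p)) * D) * ?B"
    by (rule mult_right_mono) simp
  also have "\<dots> = (ennreal (V powr (1 - 1 / p)) * ennreal (V powr (1 / q))) * (R * D) * ?X"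
    unfolding B by (simp add: mult_ac)
  also have "ennreal (V powr (1 - 1 / p)) * ennreal (V powr (1 / q)) = ennreal (V powr (1 / q + 1 - 1 / p))"
    using V by (simp add: ennreal_mult[symmetric] powr_add[symmetric] algebra_simps)
  also have "ennreal (V powr (1 / q + 1 - 1 / p)) * (R * D) * ?X
      \<le> ennreal (V powr (1 / q + 1 - 1 / p)) * ?K * ?X"
    using RD by (intro mult_right_mono mult_left_mono) auto
  finally show ?thesis .
qed simp

text \<open>The sufficiency estimate with the matrix moved into the measure \<nu>, so that the
  ordinary fractional maximal function remains. The power of $3^n$ is the ratio of
  $|3Q|^{1-\<alpha>/n}$ to $|Q|^{1-\<alpha>/n}$.\<close>

lemma emeasure_superlevel_le:
  fixes A :: "real^'n^'n" and w f :: "real^'n \<Rightarrow> real"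
  assumes p: "1 \<le> p" and pq: "p \<le> q" and \<alpha>: "\<alpha> < real CARD('n)" "1 / q = 1 / p - \<alpha> / real CARD('n)"
    and [measurable]: "w \<in> borel_measurable lebesgue" "(\<lambda>x. w (A *v x)) \<in> borel_measurable lebesgue"
      "f \<in> borel_measurable lebesgue"
    and nonneg: "\<And>x. 0 \<le> w x"
    and K: "A_const A p q w < \<infinity>" and t: "0 < t"
  defines "\<nu> \<equiv> density lebesgue (\<lambda>x. ennreal (w (A *v x) powr q))"
  shows "ennreal t * epowr (emeasure \<nu> {x. ennreal t < fractional_maximal \<alpha> f x}) (1 / q)
    \<le> ennreal ((3 ^ CARD('n)) powr (1 - \<alpha> / real CARD('n))) * A_const A p q w
      * epowr (\<integral>\<^sup>+x. ennreal ((\<bar>f x\<bar> * w x) powr p) \<partial>lebesgue) (1 / p)"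
proof -
  define s where "s = 1 - \<alpha> / real CARD('n)"
  have s: "0 < s" "1 / q + 1 - 1 / p = s" using \<alpha> by (simp_all add: s_def field_simps)
  have q: "0 < q" "1 \<le> q" using p pq by auto
  define K where "K = A_const A p q w"
  define c where "c = ennreal ((3 ^ CARD('n)) powr s / t) * K"
  define \<eta> where "\<eta> = density lebesgue (\<lambda>x. ennreal ((\<bar>f x\<bar> * w x) powr p))"
  have sets_\<nu> [simp]: "sets \<nu> = sets lebesgue" "sets \<eta> = sets lebesgue"
    by (simp_all add: \<nu>_def \<eta>_def)
  have \<nu>: "emeasure \<nu> S = (\<integral>\<^sup>+x\<in>S. ennreal (w (A *v x) powr q) \<partial>lebesgue)"
    and \<eta>: "emeasure \<eta> S = (\<integral>\<^sup>+x\<in>S. ennreal ((\<bar>f x\<bar> * w x) powr p) \<partial>lebesgue)"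
    if "S \<in> sets lebesgue" for S
    using that by (simp_all add: \<nu>_def \<eta>_def emeasure_density)
  define P where "P = {(a :: real^'n, l). 0 < l \<and>
    ennreal (t * (l ^ CARD('n)) powr s) < (\<integral>\<^sup>+y\<in>cube a l. ennreal \<bar>f y\<bar> \<partial>lebesgue)}"
  define box' where "box' = (\<lambda>(a :: real^'n, l). box a (\<chi> i. a $ i + l))"
  \<comment> \<open>Membership in \<open>P\<close> bounds \<open>t * V powr s\<close> by the
    integral of $|f|$ over the small cube; the condition on the triple brings in
    \<open>V powr s\<close> times the power of $3^n$. The positive finite factor
    \<open>V powr s\<close> cancels, leaving a bound free of the size of the cube.\<close>
  have triple: "emeasure \<nu> (cube (\<chi> i. a $ i - l) (3 * l)) \<le> epowr c q * epowr (emeasure \<eta> (cube a l)) (q / p)"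
    if "(a, l) \<in> P" for a l
  proof -
    define V where "V = l ^ CARD('n)"
    define Q where "Q = cube (\<chi> i. a $ i - l) (3 * l)"
    have l: "0 < l" and less: "ennreal (t * V powr s) < (\<integral>\<^sup>+y\<in>cube a l. ennreal \<bar>f y\<bar> \<partial>lebesgue)"
      using that by (auto simp: P_def V_def)
    have V: "0 < V" using l by (simp add: V_def)
    have "ennreal (V powr s) * (ennreal t * epowr (emeasure \<nu> Q) (1 / q))
        = ennreal (t * V powr s) * epowr (emeasure \<nu> Q) (1 / q)"
      using t by (simp add: ennreal_mult mult_ac)
    also have "\<dots> \<le> (\<integral>\<^sup>+y\<in>cube a l. ennreal \<bar>f y\<bar> \<partial>lebesgue) * epowr (emeasure \<nu> Q) (1 / q)"
      using less by (intro mult_right_mono) auto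
    also have "\<dots> \<le> ennreal (((3 * l) ^ CARD('n)) powr s) * K * epowr (emeasure \<eta> (cube a l)) (1 / p)"
    proof -
      have "0 < 3 * l" using l by simp
      from cube_mult_epowr_le_A_const[OF p q(1) assms(5,7) nonneg K this cube_subset_triple[OF l]]
      show ?thesis
        unfolding Q_def K_def s(2) \<nu>[OF sets_cube(2)] \<eta>[OF sets_cube(2)] .
    qed
    also have "\<dots> = ennreal (V powr s) * (ennreal t * (c * epowr (emeasure \<eta> (cube a l)) (1 / p)))"
    proof -
      define y where "y = (3 ^ CARD('n)) powr s / t"
      have y: "0 \<le> y" using t by (simp add: y_def)
      have "((3 * l) ^ CARD('n)) powr s = V powr s * (t * y)"
        using l t by (simp add: V_def y_def power_mult_distrib powr_mult)
      then show ?thesis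
        unfolding c_def y_def[symmetric] using t y by (simp add: ennreal_mult mult_ac)
    qed
    finally have "epowr (emeasure \<nu> Q) (1 / q) \<le> c * epowr (emeasure \<eta> (cube a l)) (1 / p)"
      using V t by (simp add: ennreal_mult_le_mult_iff)
    then have "epowr (epowr (emeasure \<nu> Q) (1 / q)) q \<le> epowr (c * epowr (emeasure \<eta> (cube a l)) (1 / p)) q"
      using q by (intro epowr_mono) auto
    then show ?thesis
      using q by (simp add: Q_def epowr_epowr epowr_mult)
  qed
  have fin: "emeasure \<nu> (\<Union>(box' ` F)) \<le> epowr c q * epowr (emeasure \<eta> UNIV) (q / p)"
    if F: "finite F" "F \<subseteq> P" for F
  proof -
    obtain G where G: "G \<subseteq> F" "disjoint_family_on (\<lambda>(a, l). cube a l) G"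
      "(\<Union>(a, l)\<in>F. cube a l) \<subseteq> (\<Union>(a, l)\<in>G. cube (\<chi> i. a $ i - l) (3 * l))"
      by (rule Vitali_covering_cubes_finite[OF F(1)])
    have finG: "finite G" using G(1) F(1) by (rule finite_subset)
    have "box' z \<subseteq> (case z of (a, l) \<Rightarrow> cube a l)" for z
      by (cases z) (simp add: box'_def cube_def box_subset_cbox)
    then have "\<Union>(box' ` F) \<subseteq> (\<Union>(a, l)\<in>F. cube a l)"
      by (rule UN_mono[OF subset_refl])
    also note G(3)
    finally have "emeasure \<nu> (\<Union>(box' ` F)) \<le> emeasure \<nu> (\<Union>(a, l)\<in>G. cube (\<chi> i. a $ i - l) (3 * l))"
      using finG by (intro emeasure_mono) auto
    also have "\<dots> \<le> (\<Sum>z\<in>G. emeasure \<nu> (case z of (a, l) \<Rightarrow> cube (\<chi> i. a $ i - l) (3 * l)))"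
      using finG by (intro emeasure_subadditive_finite) auto
    also have "\<dots> \<le> (\<Sum>z\<in>G. epowr c q * epowr (emeasure \<eta> (case z of (a, l) \<Rightarrow> cube a l)) (q / p))"
      using G(1) F(2) triple by (intro sum_mono) (auto split: prod.split)
    also have "\<dots> = epowr c q * (\<Sum>z\<in>G. epowr (emeasure \<eta> (case z of (a, l) \<Rightarrow> cube a l)) (q / p))"
      by (simp add: sum_distrib_left)
    \<comment> \<open>Here $q/p \<ge> 1$ is used; disjointness of the selected cubes then turns the
      sum of the \<eta>-masses into the mass of their union.\<close>
    also have "\<dots> \<le> epowr c q * epowr (\<Sum>z\<in>G. emeasure \<eta> (case z of (a, l) \<Rightarrow> cube a l)) (q / p)"
      using p pq by (intro mult_left_mono sum_epowr_le_epowr_sum) auto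
    also have "(\<Sum>z\<in>G. emeasure \<eta> (case z of (a, l) \<Rightarrow> cube a l)) = emeasure \<eta> (\<Union>z\<in>G. case z of (a, l) \<Rightarrow> cube a l)"
      using finG G(2) by (intro sum_emeasure) auto
    also have "epowr c q * epowr (emeasure \<eta> (\<Union>z\<in>G. case z of (a, l) \<Rightarrow> cube a l)) (q / p)
        \<le> epowr c q * epowr (emeasure \<eta> UNIV) (q / p)"
      using p q by (intro mult_left_mono epowr_mono emeasure_mono) auto
    finally show ?thesis .
  qed
  have E: "{x. ennreal t < fractional_maximal \<alpha> f x} = \<Union>(box' ` P)"
    unfolding box'_def P_def using fractional_maximal_superlevel_eq[OF s(1) _ s_def] t by simp
  have op: "open S" if "S \<in> box' ` P" for S using that by (auto simp: box'_def)
  \<comment> \<open>\<open>P\<close> is uncountable in general, but its boxes are open, so countably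
    many have the same union.\<close>
  obtain \<C> where \<C>: "\<C> \<subseteq> box' ` P" "countable \<C>" "\<Union>\<C> = \<Union>(box' ` P)"
    by (rule Lindelof[of "box' ` P", OF op])
  have "emeasure \<nu> (\<Union>\<C>) \<le> epowr c q * epowr (emeasure \<eta> UNIV) (q / p)"
  proof (rule emeasure_countable_Union_le[OF \<C>(2)])
    show "\<C> \<subseteq> sets \<nu>" using \<C>(1) op by (auto intro: borel_open)
    fix \<D> assume \<D>: "finite \<D>" "\<D> \<subseteq> \<C>"
    have "\<D> \<subseteq> box' ` P" using \<D>(2) \<C>(1) by (rule order_trans)
    with \<D>(1) obtain F where "F \<subseteq> P" "finite F" "\<D> = box' ` F"
      by (auto dest: finite_subset_image)
    then show "emeasure \<nu> (\<Union>\<D>) \<le> epowr c q * epowr (emeasure \<eta> UNIV) (q / p)"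
      using fin by simp
  qed
  then have "epowr (emeasure \<nu> {x. ennreal t < fractional_maximal \<alpha> f x}) (1 / q)
      \<le> epowr (epowr c q * epowr (emeasure \<eta> UNIV) (q / p)) (1 / q)"
    unfolding E \<C>(3) using q by (intro epowr_mono) auto
  also have "\<dots> = c * epowr (emeasure \<eta> UNIV) (1 / p)"
    using q by (simp add: epowr_mult epowr_epowr)
  finally have "ennreal t * epowr (emeasure \<nu> {x. ennreal t < fractional_maximal \<alpha> f x}) (1 / q)
      \<le> ennreal t * (c * epowr (emeasure \<eta> UNIV) (1 / p))"
    by (rule mult_left_mono) simp
  also have "\<dots> = (ennreal t * ennreal ((3 ^ CARD('n)) powr s / t)) * K * epowr (emeasure \<eta> UNIV) (1 / p)"
    by (simp add: c_def mult_ac)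
  also have "ennreal t * ennreal ((3 ^ CARD('n)) powr s / t) = ennreal ((3 ^ CARD('n)) powr s)"
    using t by (simp add: ennreal_mult[symmetric])
  finally show ?thesis by (simp add: \<eta> K_def s_def)
qed

theorem theorem1p1:
  fixes A :: "real^'n^'n" and \<alpha> p q :: real and w :: "real^'n \<Rightarrow> real"
  assumes "invertible A"
    and "0 \<le> \<alpha>" and "\<alpha> < real CARD('n)"
    and "1 \<le> p" and "\<alpha> = 0 \<or> p < real CARD('n) / \<alpha>"
    and "1 / q = 1 / p - \<alpha> / real CARD('n)"
    and "weight w"
  shows "bounded_Lp_weak_Lq (weighted_measure (\<lambda>x. w x powr p)) p
           (weighted_measure (\<lambda>x. w x powr q)) q (maximal_inv_matrix \<alpha> A)
         \<longleftrightarrow> w \<in> A_class A p q"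
    (is "?bounded \<longleftrightarrow> _")
proof -
  let ?n = "real CARD('n)"
  define s where "s = 1 - \<alpha> / ?n"
  have s: "0 < s" "1 / q + 1 - 1 / p = s" using assms by (simp_all add: s_def field_simps)
  have "\<alpha> / ?n < 1 / p"
    using assms(2,4,5) by (cases "\<alpha> = 0") (auto simp: field_simps)
  then have "0 < 1 / q" using assms(6) by simp
  then have q: "0 < q" by simp
  have "1 / q \<le> 1 / p" using assms(2,6) by simp
  then have pq: "p \<le> q" using q assms(4) by (simp add: field_simps)
  have nonneg: "0 \<le> w x" for x using assms(7) by (simp add: weight_def)
  note w_meas [measurable] = weight_measurable[OF assms(7)]
  define B where "B = matrix_inv A"
  have AB: "A *v (B *v x) = x" "B *v (A *v x) = x" for x
    using assms(1) by (simp_all add: B_def matrix_vector_mul_assoc invertible_matrix_inv)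
  obtain m :: real where m: "0 < m" and A_meas: "(*v) A \<in> lebesgue \<rightarrow>\<^sub>M lebesgue"
    and scale: "\<And>f. f \<in> borel_measurable lebesgue \<Longrightarrow>
      (\<integral>\<^sup>+x. f x \<partial>lebesgue) = ennreal m * (\<integral>\<^sup>+x. f (A *v x) \<partial>lebesgue)"
    using lebesgue_linear_scaling[of "(*v) A" "(*v) B"] AB by auto
  have wA_meas [measurable]: "(\<lambda>x. w (A *v x)) \<in> borel_measurable lebesgue"
    by (rule measurable_compose[OF A_meas w_meas])
  let ?M = "weighted_measure (\<lambda>x. w x powr p)"
  let ?N = "weighted_measure (\<lambda>x. w x powr q)"
  define \<nu> where "\<nu> = density lebesgue (\<lambda>x. ennreal (w (A *v x) powr q))"
  have B_meas: "(*v) B \<in> borel_measurable borel"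
    by (intro borel_measurable_continuous_onI matrix_vector_mult_linear_continuous_on)
  \<comment> \<open>The set in question is the image of \<open>E\<close> under \<open>A\<close>; the
    scaling of Lebesgue measure turns its $w^q$-mass into \<open>m\<close> times a
    \<nu>-mass.\<close>
  have vimage: "{x. B *v x \<in> E} \<in> sets lebesgue" "emeasure ?N {x. B *v x \<in> E} = ennreal m * emeasure \<nu> E"
    if E: "E \<in> sets borel" for E
  proof -
    have "{x. B *v x \<in> E} = (*v) B -` E \<inter> space borel" by auto
    also have "\<dots> \<in> sets borel" by (rule measurable_sets[OF B_meas E])
    finally show 1 [measurable]: "{x. B *v x \<in> E} \<in> sets lebesgue" by simp
    have "emeasure ?N {x. B *v x \<in> E}
        = (\<integral>\<^sup>+x. ennreal (w x powr q) * indicator {x. B *v x \<in> E} x \<partial>lebesgue)"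
      unfolding weighted_measure_def by (rule emeasure_density) measurable
    also have "\<dots> = ennreal m * (\<integral>\<^sup>+x. ennreal (w (A *v x) powr q) * indicator {x. B *v x \<in> E} (A *v x) \<partial>lebesgue)"
      by (rule scale) measurable
    also have "(\<lambda>x. indicator {x. B *v x \<in> E} (A *v x) :: ennreal) = indicator E"
      by (auto simp: indicator_def AB)
    also have "(\<integral>\<^sup>+x. ennreal (w (A *v x) powr q) * indicator E x \<partial>lebesgue) = emeasure \<nu> E"
      using E unfolding \<nu>_def by (subst emeasure_density) auto
    finally show "emeasure ?N {x. B *v x \<in> E} = ennreal m * emeasure \<nu> E" .
  qed
  have space_N [simp]: "space ?N = UNIV" by (simp add: weighted_measure_def)
  have superlevel: "{x \<in> space ?N. y < maximal_inv_matrix \<alpha> A f x} = {x. B *v x \<in> {z. y < fractional_maximal \<alpha> f z}}"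
    for f y by (simp add: maximal_inv_matrix_def B_def)
  have open_E: "open {z. ennreal t < fractional_maximal \<alpha> f z}" if "0 \<le> t" for t and f :: "real^'n \<Rightarrow> real"
    using open_fractional_maximal_superlevel[OF assms(3) that] .
  have T_meas: "maximal_inv_matrix \<alpha> A f \<in> borel_measurable ?N" for f
  proof (rule borel_measurableI_greater)
    fix y
    show "{x \<in> space ?N. y < maximal_inv_matrix \<alpha> A f x} \<in> sets ?N"
    proof (cases y)
      case (real t)
      then show ?thesis
        unfolding superlevel using vimage(1)[OF borel_open[OF open_E[of t f]]]
        by (simp add: weighted_measure_def)
    qed simp
  qed
  show ?thesis
  proof

    \<comment> \<open>Sufficiency: the superlevel estimate transported by the matrix\<close>
    assume "w \<in> A_class A p q"
    then have K: "A_const A p q w < \<infinity>" by (simp add: A_class_def)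
    \<comment> \<open>The factor \<open>m\<close> of the change of variables enters under the power
      $1/q$ of the weak norm.\<close>
    define c where "c = epowr (ennreal m) (1 / q) * (ennreal ((3 ^ CARD('n)) powr s) * A_const A p q w)"
    have "c < top" using K m by (simp add: c_def epowr_ennreal ennreal_mult_less_top)
    then have c: "ennreal (enn2real c) = c" by simp
    have "weak_Lp_norm ?N q (maximal_inv_matrix \<alpha> A f) \<le> c * Lp_norm ?M p f"
      if "f \<in> Lp_space ?M p" for f
      unfolding weak_Lp_norm_def
    proof (rule SUP_least)
      fix t :: real assume "t \<in> {0<..}"
      then have t: "0 < t" by simp
      have f [measurable]: "f \<in> borel_measurable lebesgue"
        using that by (simp add: Lp_space_def borel_measurable_weighted_measure)
      let ?E = "{z. ennreal t < fractional_maximal \<alpha> f z}"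
      have "ennreal t * epowr (emeasure ?N {x \<in> space ?N. ennreal t < maximal_inv_matrix \<alpha> A f x}) (1 / q)
          = epowr (ennreal m) (1 / q) * (ennreal t * epowr (emeasure \<nu> ?E) (1 / q))"
        unfolding superlevel using vimage(2)[OF borel_open[OF open_E[of t f]]] t
        by (simp add: epowr_mult mult_ac)
      also have "\<dots> \<le> epowr (ennreal m) (1 / q) * (ennreal ((3 ^ CARD('n)) powr s) * A_const A p q w
          * epowr (\<integral>\<^sup>+x. ennreal ((\<bar>f x\<bar> * w x) powr p) \<partial>lebesgue) (1 / p))"
        unfolding \<nu>_def s_def
        using assms(3,4,6) pq nonneg K t by (intro mult_left_mono emeasure_superlevel_le) auto
      also have "\<dots> = c * Lp_norm ?M p f"
        by (simp add: Lp_norm_weighted_measure nonneg c_def mult_ac)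
      finally show "ennreal t * epowr (emeasure ?N {x \<in> space ?N. ennreal t < maximal_inv_matrix \<alpha> A f x}) (1 / q)
          \<le> c * Lp_norm ?M p f" .
    qed
    moreover have "c * Lp_norm ?M p f < \<infinity>" if "f \<in> Lp_space ?M p" for f
      using that \<open>c < top\<close> by (simp add: Lp_space_def ennreal_mult_less_top)
    ultimately show ?bounded
      unfolding bounded_Lp_weak_Lq_def weak_Lp_space_def
      by (intro exI[of _ "enn2real c"]) (auto simp: c T_meas intro: le_less_trans)
  next

    \<comment> \<open>Necessity: testing on a single cube\<close>
    assume ?bounded
    then obtain C :: real where C: "\<And>f. f \<in> Lp_space ?M p \<Longrightarrow>
        weak_Lp_norm ?N q (maximal_inv_matrix \<alpha> A f) \<le> ennreal C * Lp_norm ?M p f"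
      unfolding bounded_Lp_weak_Lq_def by blast
    \<comment> \<open>The bound \<open>C\<close> may be zero or negative, whereas the duality lemma
      takes a positive constant.\<close>
    define C' where "C' = max C 1"
    have C': "0 < C'" "ennreal C \<le> ennreal C'" by (auto simp: C'_def intro!: ennreal_leI)
    have "epowr (average Q (\<lambda>x. ennreal (w (A *v x) powr q))) (1 / q) * dual_factor p w Q
        \<le> ennreal (C' / m powr (1 / q))" if "Q \<in> cubes" for Q :: "(real^'n) set"
    proof -
      obtain a l where l: "0 < l" and Q: "Q = cube a l" using \<open>Q \<in> cubes\<close> by (auto elim: cubesE)
      define V where "V = l ^ CARD('n)"
      have V: "emeasure lebesgue Q = ennreal V" "0 < V"
        using emeasure_cube[OF l, of a] l by (simp_all add: V_def Q)
      have Q_meas [measurable]: "Q \<in> sets lebesgue" "Q \<in> sets borel" by (simp_all add: Q sets_cube)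
      \<comment> \<open>By the change of variables, \<open>b\<close> is the $1/q$-th power of the
        $w^q$-mass of the image of \<open>Q\<close> under \<open>A\<close>.\<close>
      define b where "b = epowr (ennreal m * emeasure \<nu> Q) (1 / q)"
      have test: "b * (\<integral>\<^sup>+x\<in>Q. ennreal \<bar>f x\<bar> \<partial>lebesgue)
        \<le> ennreal (C' * V powr s) * epowr (\<integral>\<^sup>+x\<in>Q. ennreal ((\<bar>f x\<bar> * w x) powr p) \<partial>lebesgue) (1 / p)"
        (is "b * ?F \<le> _ * ?X")
        if f [measurable]: "f \<in> borel_measurable lebesgue" for f
      \<comment> \<open>Duality asks for every measurable \<open>f\<close>, while boundedness speaks
        of functions of finite norm; the remaining ones satisfy the inequality because its right
        side is infinite.\<close>
      proof (cases "?X = top")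
        case True
        then show ?thesis using C' V by (simp add: ennreal_mult_top)
      next
        case False
        define g where "g = (\<lambda>x. indicat_real Q x * f x)"
        have g [measurable]: "g \<in> borel_measurable lebesgue" unfolding g_def by measurable
        have norm_g: "Lp_norm ?M p g = ?X"
        proof -
          have "(\<integral>\<^sup>+x. ennreal ((\<bar>g x\<bar> * w x) powr p) \<partial>lebesgue)
              = (\<integral>\<^sup>+x\<in>Q. ennreal ((\<bar>f x\<bar> * w x) powr p) \<partial>lebesgue)"
            by (intro nn_integral_cong) (auto simp: g_def indicator_def)
          then show ?thesis by (simp add: Lp_norm_weighted_measure nonneg)
        qed
        then have "g \<in> Lp_space ?M p"
          using False by (simp add: Lp_space_def borel_measurable_weighted_measure top.not_eq_extremum[symmetric])
        then have "weak_Lp_norm ?N q (maximal_inv_matrix \<alpha> A g) \<le> ennreal C * ?X"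
          using C norm_g by force
        also have "\<dots> \<le> ennreal C' * ?X" using C' by (intro mult_right_mono) auto
        finally have weak: "weak_Lp_norm ?N q (maximal_inv_matrix \<alpha> A g) \<le> ennreal C' * ?X" .
        \<comment> \<open>At every point of \<open>Q\<close> the maximal function of
          \<open>g\<close> is at least this quotient, so each smaller level \<open>t\<close> is
          exceeded on the whole image of \<open>Q\<close> under \<open>A\<close>.\<close>
        have "(?F / ennreal (V powr s)) * b \<le> ennreal C' * ?X"
        proof (rule ennreal_mult_le_if_lessThan)
          fix t :: real assume t: "0 < t" "ennreal t < ?F / ennreal (V powr s)"
          have gF: "(\<integral>\<^sup>+x\<in>Q. ennreal \<bar>g x\<bar> \<partial>lebesgue) = ?F"
            by (intro nn_integral_cong) (auto simp: g_def indicator_def)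
          have "ennreal t < fractional_maximal \<alpha> g z" if "z \<in> Q" for z
          proof -
            have "measure lebesgue Q = V" using V by (simp add: measure_def)
            then have "?F / ennreal (V powr s) \<le> fractional_maximal \<alpha> g z"
              unfolding fractional_maximal_def using that \<open>Q \<in> cubes\<close> gF
              by (intro SUP_upper2[of Q]) (auto simp: s_def)
            with t(2) show ?thesis by (rule less_le_trans)
          qed
          then have sub: "{x. B *v x \<in> Q} \<subseteq> {x \<in> space ?N. ennreal t < maximal_inv_matrix \<alpha> A g x}"
            unfolding superlevel by auto
          have sets_T: "{x \<in> space ?N. ennreal t < maximal_inv_matrix \<alpha> A g x} \<in> sets ?N"
            using T_meas[of g] by measurable
          have "b \<le> epowr (emeasure ?N {x \<in> space ?N. ennreal t < maximal_inv_matrix \<alpha> A g x}) (1 / q)"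
            unfolding b_def vimage(2)[OF Q_meas(2), symmetric]
            using q by (intro epowr_mono emeasure_mono[OF sub] sets_T) auto
          then have "ennreal t * b \<le> ennreal t
              * epowr (emeasure ?N {x \<in> space ?N. ennreal t < maximal_inv_matrix \<alpha> A g x}) (1 / q)"
            by (rule mult_left_mono) simp
          also have "\<dots> \<le> weak_Lp_norm ?N q (maximal_inv_matrix \<alpha> A g)"
            unfolding weak_Lp_norm_def using t by (intro SUP_upper) auto
          also note weak
          finally show "ennreal t * b \<le> ennreal C' * ?X" .
        qed
        then have "ennreal (V powr s) * ((?F / ennreal (V powr s)) * b) \<le> ennreal (V powr s) * (ennreal C' * ?X)"
          by (rule mult_left_mono) simp
        moreover have "ennreal (V powr s) * (?F / ennreal (V powr s)) = ?F"
          using V by (simp add: ennreal_times_divide mult.commute[of "ennreal _"] ennreal_mult_divide_eq)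
        ultimately show ?thesis
          using C' by (simp add: mult.assoc[symmetric] ennreal_mult) (simp add: mult_ac)
      qed
      define R where "R = epowr (average Q (\<lambda>x. ennreal (w (A *v x) powr q))) (1 / q)"
      have b: "b = ennreal (m powr (1 / q)) * (ennreal (V powr (1 / q)) * R)"
        using m unfolding b_def R_def epowr_average[OF V] \<nu>_def
        by (simp add: emeasure_density epowr_mult epowr_ennreal)
      \<comment> \<open>Duality replaces the family of tests by a bound on the dual factor;
        \<open>V powr (1 / q)\<close> inside \<open>b\<close> and \<open>V powr (1 - 1 / p)\<close>
        multiply to \<open>V powr s\<close>, which cancels against the right side.\<close>
      have "b * (ennreal (V powr (1 - 1 / p)) * dual_factor p w Q) \<le> ennreal (C' * V powr s)"
        by (rule dual_factor_le[OF assms(4) w_meas nonneg Q_meas(1) V]) (use C' V test in auto)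
      moreover have "ennreal (V powr (1 / q)) * ennreal (V powr (1 - 1 / p)) = ennreal (V powr s)"
        using V by (simp add: ennreal_mult[symmetric] powr_add[symmetric] s(2)[symmetric] algebra_simps)
      ultimately have "ennreal (m powr (1 / q)) * ennreal (V powr s) * (R * dual_factor p w Q) \<le> ennreal (C' * V powr s)"
        unfolding b by (metis (no_types, lifting) mult.assoc mult.left_commute)
      also have "ennreal (C' * V powr s) = ennreal (m powr (1 / q)) * ennreal (V powr s) * ennreal (C' / m powr (1 / q))"
        using m V C' by (simp add: ennreal_mult[symmetric])
      finally show ?thesis
        unfolding R_def using m V
        by (subst (asm) ennreal_mult_le_mult_iff) (simp_all add: ennreal_mult_eq_top_iff)
    qed
    then have "A_const A p q w \<le> ennreal (C' / m powr (1 / q))"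
      unfolding A_const_eq by (rule SUP_least)
    then show "w \<in> A_class A p q"
      using assms(7) by (simp add: A_class_def le_less_trans)
  qed
qed

end
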